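(* Let $(\phi_t)$ be a parabolic semigroup of zero hyperbolic step in $\mathbb{H}$ with Denjoy--Wolff point $\infty$. The following are equivalent: (a) $(\phi_t)$ is of extremal rate; (b) $\limsup_{t\to+\infty}\left(d_{\mathbb{H}}(i,\phi_t(z))-\frac14\log t\right)<+\infty$ for some (equivalently, all) $z\in\mathbb{H}$; (c) $\lim_{t\to+\infty}\left(d_{\mathbb{H}}(i,\phi_t(z))-\frac14\log t\right)$ exists in $\mathbb{R}$ for some (equivalently, all) $z\in\mathbb{H}$. Moreover, if these hold, then for all $z\in\mathbb{H}$, $$\lim_{t\to+\infty}\left(d_{\mathbb{H}}(i,\phi_t(z))-\frac14\log t\right)=\frac12\log\left(\lim_{t\to+\infty}\frac{|\phi_t(i)|}{\sqrt t}\right).$$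
   Context: $\mathbb{H}$ is the upper half-plane with hyperbolic distance $d_{\mathbb{H}}(z,w)=\frac12\log\frac{1+\rho}{1-\rho}$, $\rho=|z-w|/|z-\bar w|$. A semigroup in $\mathbb{H}$ is a family $(\phi_t)_{t\ge0}$ of holomorphic self-maps of $\mathbb{H}$ with $\phi_0=\mathrm{id}$, $\phi_{t+s}=\phi_t\circ\phi_s$, and $\phi_t\to\mathrm{id}$ pointwise as $t\to0^+$. Non-elliptic: no fixed points of $\phi_t$, $t>0$, in $\mathbb{H}$; orbits converge to a common boundary point (Denjoy--Wolff point). With Denjoy--Wolff point $\infty$, parabolic means $\angle\lim_{z\to\infty}\phi_t(z)/z=1$; zero hyperbolic step means $d_{\mathbb{H}}(\phi_{t+1}(z),\phi_t(z))\to0$ as $t\to+\infty$. Extremal rate: there is $L\in(0,+\infty)$ with $\lim_{t\to+\infty}|\phi_t(z)|/\sqrt t=L$ for all $z\in\mathbb{H}$. *)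

theory Defs
  imports "HOL-Analysis.Analysis"
begin

definition upper_half_plane :: "complex set" ("\<H>") where
  "\<H> = {z. Im z > 0}"

definition hdist :: "complex \<Rightarrow> complex \<Rightarrow> real" where
  "hdist z w = (let \<rho> = cmod (z - w) / cmod (z - cnj w) in ln ((1 + \<rho>) / (1 - \<rho>)) / 2)"

definition semigroup_H :: "(real \<Rightarrow> complex \<Rightarrow> complex) \<Rightarrow> bool" where
  "semigroup_H \<phi> \<longleftrightarrow>
     (\<forall>t\<ge>0. \<phi> t holomorphic_on \<H> \<and> \<phi> t ` \<H> \<subseteq> \<H>) \<and>
     (\<forall>z\<in>\<H>. \<phi> 0 z = z) \<and>
     (\<forall>s\<ge>0. \<forall>t\<ge>0. \<forall>z\<in>\<H>. \<phi> (t + s) z = \<phi> t (\<phi> s z)) \<and>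
     (\<forall>z\<in>\<H>. ((\<lambda>t. \<phi> t z) \<longlongrightarrow> z) (at_right 0))"

definition nonelliptic_DW_infty :: "(real \<Rightarrow> complex \<Rightarrow> complex) \<Rightarrow> bool" where
  "nonelliptic_DW_infty \<phi> \<longleftrightarrow>
     (\<forall>t>0. \<forall>z\<in>\<H>. \<phi> t z \<noteq> z) \<and>
     (\<forall>z\<in>\<H>. filterlim (\<lambda>t. \<phi> t z) at_infinity at_top)"

definition angular_lim_infty :: "(complex \<Rightarrow> complex) \<Rightarrow> complex \<Rightarrow> bool" where
  "angular_lim_infty f L \<longleftrightarrow>
     (\<forall>M>0. (f \<longlongrightarrow> L) (inf at_infinity (principal {z. Im z > 0 \<and> \<bar>Re z\<bar> \<le> M * Im z})))"

definition parabolic_H :: "(real \<Rightarrow> complex \<Rightarrow> complex) \<Rightarrow> bool" where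
  "parabolic_H \<phi> \<longleftrightarrow> (\<forall>t\<ge>0. angular_lim_infty (\<lambda>z. \<phi> t z / z) 1)"

definition zero_hyp_step :: "(real \<Rightarrow> complex \<Rightarrow> complex) \<Rightarrow> bool" where
  "zero_hyp_step \<phi> \<longleftrightarrow>
     (\<forall>z\<in>\<H>. ((\<lambda>t. hdist (\<phi> (t + 1) z) (\<phi> t z)) \<longlongrightarrow> 0) at_top)"

definition extremal_rate :: "(real \<Rightarrow> complex \<Rightarrow> complex) \<Rightarrow> bool" where
  "extremal_rate \<phi> \<longleftrightarrow>
     (\<exists>L>0. \<forall>z\<in>\<H>. ((\<lambda>t. cmod (\<phi> t z) / sqrt t) \<longlongrightarrow> L) at_top)"

end

theory Submission
  imports Defs "HOL-Complex_Analysis.Complex_Analysis"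
begin

text \<open>
  Each of (a), (b), (c) implies that some orbit satisfies \<open>|\<phi>\<^sub>t(z)| = O(\<surd>t)\<close>, and this bound alone forces
  \<open>\<phi>\<^sub>t(z) / \<surd>t \<rightarrow> \<i>L\<close> with \<open>L\<close> independent of \<open>z\<close>; the formula
  \<open>d(\<i>, w) = 1/2 log ((|w + \<i>| + |w - \<i>|)\<^sup>2 / (4 Im w))\<close> then gives the limit of the distance.

  The semigroup has an infinitesimal generator \<open>G\<close> mapping \<open>\<H>\<close> to its closure. Along an orbit \<open>w\<close>,
  the logarithm of the velocity \<open>G w\<close> has derivative \<open>G' w\<close>, and Schwarz--Pick bounds it by
  \<open>Im (G w) / Im w\<close>, the derivative of \<open>log (Im w)\<close>. Hence \<open>Im w |G w|\<close> is nondecreasing, and the velocity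
  turns little as long as \<open>Im w\<close> grows little. An orbit running close to the real axis would therefore
  be so fast that it violates \<open>|w| = O(\<surd>t)\<close>, so \<open>Im w \<ge> c \<surd>t\<close>. Inside such a cone
  \<open>-1/G = \<beta> z + o(z)\<close> by Julia--Caratheodory, and integrating \<open>(-1/G)(w) w' = -1\<close> yields
  \<open>\<beta> w\<^sup>2 / 2 \<sim> -t\<close>, which gives \<open>\<beta> > 0\<close> and \<open>L = \<surd>(2/\<beta>)\<close>.
\<close>

section \<open>Schwarz--Pick estimates in the half-plane\<close>

lemma mem_upper_half_plane [simp]: "z \<in> \<H> \<longleftrightarrow> Im z > 0"
  by (simp add: upper_half_plane_def)

lemma open_upper_half_plane: "open \<H>"
  unfolding upper_half_plane_def by (rule open_halfspace_Im_gt)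

lemma convex_upper_half_plane: "convex \<H>"
  unfolding upper_half_plane_def by (rule convex_halfspace_Im_gt)

text \<open>Eliminates the reflected point: contraction of \<open>|z - w| / |z - cnj w|\<close>
  becomes an inequality in \<open>|z - w|\<close> and \<open>Im z * Im w\<close> without
  division.\<close>

lemma cmod_diff_cnj_squared: "(cmod (z - cnj w))\<^sup>2 = (cmod (z - w))\<^sup>2 + 4 * Im z * Im w"
  by (simp only: cmod_power2) (simp add: power2_eq_square algebra_simps)

text \<open>Cayley transforms at \<open>w\<close> and \<open>f w\<close> turn \<open>f\<close> into
  a self-map of the disc fixing 0, to which the Schwarz lemma applies. The product form stays
  meaningful when imaginary parts degenerate to 0.\<close>

lemma Schwarz_Pick_strict:
  assumes f: "f holomorphic_on \<H>" and pos: "\<And>z. z \<in> \<H> \<Longrightarrow> Im (f z) > 0"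
    and zw: "Im z > 0" "Im w > 0"
  shows "(cmod (f z - f w))\<^sup>2 * (Im z * Im w) \<le> (cmod (z - w))\<^sup>2 * (Im (f z) * Im (f w))"
proof -
  \<comment> \<open>\<open>C\<close> maps the disc to the half-plane with \<open>C 0 = w\<close>,
    \<open>\<zeta>0\<close> is the preimage of \<open>z\<close>, and \<open>F\<close> is
    \<open>f\<close> read in these coordinates with \<open>f w\<close> sent to 0.\<close>
  define C where "C = (\<lambda>\<zeta>. (w - cnj w * \<zeta>) / (1 - \<zeta>))"
  define F where "F = (\<lambda>\<zeta>. (f (C \<zeta>) - f w) / (f (C \<zeta>) - cnj (f w)))"
  define \<zeta>0 where "\<zeta>0 = (z - w) / (z - cnj w)"
  have ImC: "Im (C \<zeta>) > 0" if "cmod \<zeta> < 1" for \<zeta>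
  proof -
    have ne: "1 - \<zeta> \<noteq> 0" using that by auto
    have "C \<zeta> = (w - cnj w * \<zeta>) * cnj (1 - \<zeta>) / of_real ((cmod (1 - \<zeta>))\<^sup>2)"
      unfolding C_def using ne by (subst complex_div_cnj) simp
    then have "Im (C \<zeta>) = Im ((w - cnj w * \<zeta>) * cnj (1 - \<zeta>)) / (cmod (1 - \<zeta>))\<^sup>2"
      by (metis Im_divide_of_real)
    also have "Im ((w - cnj w * \<zeta>) * cnj (1 - \<zeta>)) = Im w * (1 - (cmod \<zeta>)\<^sup>2)"
      by (simp only: cmod_power2) (simp add: power2_eq_square algebra_simps)
    finally have "Im (C \<zeta>) = Im w * (1 - (cmod \<zeta>)\<^sup>2) / (cmod (1 - \<zeta>))\<^sup>2" .
    moreover have "(cmod \<zeta>)\<^sup>2 < 1" using that by (simp add: abs_square_less_1)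
    ultimately show ?thesis using ne zw by (simp add: zero_less_divide_iff)
  qed
  have nz: "a - cnj b \<noteq> 0" if "Im a > 0" "Im b > 0" for a b
  proof
    assume "a - cnj b = 0"
    then have "Im (a - cnj b) = 0" by (simp only:) simp
    with that show False by simp
  qed
  have lt: "cmod (a - b) < cmod (a - cnj b)" if "Im a > 0" "Im b > 0" for a b
    by (rule power2_less_imp_less) (use that in \<open>auto simp: cmod_diff_cnj_squared\<close>)
  have "C holomorphic_on ball 0 1"
    unfolding C_def by (intro holomorphic_intros) auto
  moreover have "C ` ball 0 1 \<subseteq> \<H>" using ImC by auto
  ultimately have fC: "(\<lambda>\<zeta>. f (C \<zeta>)) holomorphic_on ball 0 1"
    using holomorphic_on_compose_gen[OF _ f] by (simp add: o_def)
  have "F holomorphic_on ball 0 1"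
    unfolding F_def
    by (intro holomorphic_intros fC) (use ImC pos zw nz in force)
  moreover have "F 0 = 0" by (simp add: F_def C_def)
  moreover have "cmod (F \<zeta>) < 1" if "cmod \<zeta> < 1" for \<zeta>
  proof -
    have "Im (f (C \<zeta>)) > 0" "Im (f w) > 0" using ImC[OF that] pos zw by auto
    from lt[OF this] nz[OF this] show ?thesis by (simp add: F_def norm_divide divide_less_eq)
  qed
  moreover have "cmod \<zeta>0 < 1"
    using lt[OF zw] nz[OF zw] by (simp add: \<zeta>0_def norm_divide divide_less_eq)
  ultimately have "cmod (F \<zeta>0) \<le> cmod \<zeta>0" by (rule Schwarz_Lemma(1))
  moreover have "C \<zeta>0 = z"
  proof -
    have "1 - \<zeta>0 = (w - cnj w) / (z - cnj w)"
      using nz[OF zw] by (simp add: \<zeta>0_def field_simps)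
    moreover have "w - cnj w * \<zeta>0 = z * (w - cnj w) / (z - cnj w)"
      using nz[OF zw] by (simp add: \<zeta>0_def field_simps)
    moreover have "w - cnj w \<noteq> 0" using nz[of w w] zw by simp
    ultimately show ?thesis using nz[OF zw] by (simp add: C_def)
  qed
  ultimately have le: "cmod (f z - f w) / cmod (f z - cnj (f w)) \<le> cmod (z - w) / cmod (z - cnj w)"
    by (simp add: F_def \<zeta>0_def norm_divide)
  have fzw: "Im (f z) > 0" "Im (f w) > 0" using pos zw by auto
  have pp: "cmod (f z - cnj (f w)) > 0" "cmod (z - cnj w) > 0" using nz fzw zw by auto
  have "cmod (f z - f w) * cmod (z - cnj w) \<le> cmod (z - w) * cmod (f z - cnj (f w))"
    using le pp by (simp add: divide_simps mult.commute split: if_splits)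
  then have "(cmod (f z - f w) * cmod (z - cnj w))\<^sup>2 \<le> (cmod (z - w) * cmod (f z - cnj (f w)))\<^sup>2"
    by (intro power_mono) auto
  then have "(cmod (f z - f w))\<^sup>2 * (cmod (z - cnj w))\<^sup>2 \<le> (cmod (z - w))\<^sup>2 * (cmod (f z - cnj (f w)))\<^sup>2"
    by (simp add: power_mult_distrib)
  then show ?thesis unfolding cmod_diff_cnj_squared by (simp add: algebra_simps)
qed

text \<open>Nevanlinna (Pick) functions. Admitting \<open>Im (f z) = 0\<close> keeps limits of
  difference quotients in the class, and also \<open>g z - \<beta> * z\<close> for the largest
  possible \<open>\<beta>\<close>.\<close>

definition nevanlinna :: "(complex \<Rightarrow> complex) \<Rightarrow> bool" where
  "nevanlinna f \<longleftrightarrow> f holomorphic_on \<H> \<and> (\<forall>z\<in>\<H>. Im (f z) \<ge> 0)"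

lemma nevanlinnaI: "f holomorphic_on \<H> \<Longrightarrow> (\<And>z. Im z > 0 \<Longrightarrow> Im (f z) \<ge> 0) \<Longrightarrow> nevanlinna f"
  by (simp add: nevanlinna_def)

lemma nevanlinna_holomorphic: "nevanlinna f \<Longrightarrow> f holomorphic_on \<H>"
  and nevanlinna_Im: "nevanlinna f \<Longrightarrow> Im z > 0 \<Longrightarrow> Im (f z) \<ge> 0"
  by (auto simp: nevanlinna_def)

text \<open>Adding \<open>\<i> * e\<close> moves the values into the open half-plane; then
  \<open>e\<close> tends to 0.\<close>

theorem Schwarz_Pick:
  assumes f: "nevanlinna f" and zw: "Im z > 0" "Im w > 0"
  shows "(cmod (f z - f w))\<^sup>2 * (Im z * Im w) \<le> (cmod (z - w))\<^sup>2 * (Im (f z) * Im (f w))"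
proof -
  have "(cmod (f z - f w))\<^sup>2 * (Im z * Im w) \<le> (cmod (z - w))\<^sup>2 * ((Im (f z) + e) * (Im (f w) + e))"
    if "e > 0" for e :: real
  proof -
    have "(\<lambda>z. f z + \<i> * of_real e) holomorphic_on \<H>"
      using nevanlinna_holomorphic[OF f] by (intro holomorphic_intros)
    from Schwarz_Pick_strict[OF this _ zw] show ?thesis
      using nevanlinna_Im[OF f] that by (simp add: add_nonneg_pos)
  qed
  then have "\<forall>\<^sub>F e in at_right 0. (cmod (f z - f w))\<^sup>2 * (Im z * Im w)
      \<le> (cmod (z - w))\<^sup>2 * ((Im (f z) + e) * (Im (f w) + e))"
    by (simp add: eventually_at_right_less eventually_mono[OF eventually_at_right_less])
  moreover have "((\<lambda>e. (cmod (z - w))\<^sup>2 * ((Im (f z) + e) * (Im (f w) + e)))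
     \<longlongrightarrow> (cmod (z - w))\<^sup>2 * ((Im (f z) + 0) * (Im (f w) + 0))) (at_right 0)"
    by (intro tendsto_intros)
  ultimately show ?thesis
    using tendsto_lowerbound by fastforce
qed

text \<open>The two-point inequality is divided by \<open>|w - z|\<^sup>2\<close> and
  \<open>w\<close> tends to \<open>z\<close>.\<close>

lemma Schwarz_Pick_deriv:
  assumes f: "nevanlinna f" and z: "Im z > 0"
  shows "cmod (deriv f z) \<le> Im (f z) / Im z"
proof -
  have D: "(f has_field_derivative deriv f z) (at z)"
    using nevanlinna_holomorphic[OF f] open_upper_half_plane z by (intro holomorphic_derivI) auto
  then have L: "((\<lambda>w. (cmod ((f w - f z) / (w - z)))\<^sup>2 * (Im w * Im z)) \<longlongrightarrow> (cmod (deriv f z))\<^sup>2 * (Im z * Im z)) (at z)"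
    unfolding has_field_derivative_iff by (intro tendsto_intros)
  have "isCont f z" using D DERIV_isCont by blast
  then have R: "((\<lambda>w. Im (f w) * Im (f z)) \<longlongrightarrow> Im (f z) * Im (f z)) (at z)"
    by (intro tendsto_intros) (simp add: isCont_def)
  have "\<forall>\<^sub>F w in at z. w \<in> \<H>"
    by (rule eventually_at_in_open'[OF open_upper_half_plane]) (use z in simp)
  moreover have "\<forall>\<^sub>F w in at z. w \<noteq> z" by (simp add: eventually_at_filter)
  ultimately have "\<forall>\<^sub>F w in at z. (cmod ((f w - f z) / (w - z)))\<^sup>2 * (Im w * Im z) \<le> Im (f w) * Im (f z)"
  proof eventually_elim
    case (elim w)
    with Schwarz_Pick[OF f _ z, of w] show ?case
      by (simp add: norm_divide power_divide divide_simps mult.commute split: if_splits)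
  qed
  then have "(cmod (deriv f z))\<^sup>2 * (Im z * Im z) \<le> Im (f z) * Im (f z)"
    by (intro tendsto_le[OF _ R L]) auto
  then have "(cmod (deriv f z) * Im z)\<^sup>2 \<le> (Im (f z))\<^sup>2"
    by (simp add: power2_eq_square algebra_simps)
  then have "cmod (deriv f z) * Im z \<le> Im (f z)"
    using nevanlinna_Im[OF f z] power2_le_imp_le by blast
  then show ?thesis using z by (simp add: field_simps)
qed

text \<open>The hypothesis is the shape in which Schwarz--Pick bounds \<open>X = |f z - f w|\<close>, with \<open>a = Im (f w)\<close>.\<close>
lemma square_le_imp_le:
  fixes X a b :: real
  assumes "X\<^sup>2 \<le> (X + a) * b" "a \<ge> 0" "b \<ge> 0"
  shows "X \<le> b + sqrt (a * b)"
proof (rule ccontr)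
  assume "\<not> X \<le> b + sqrt (a * b)"
  then have X: "X > b + sqrt (a * b)" by simp
  have "sqrt (a*b) \<ge> 0" "(sqrt (a*b))\<^sup>2 = a * b" using assms by auto
  \<comment> \<open>The hypothesis reads \<open>(X - b) * X \<le> a * b\<close>, but here both
    factors exceed \<open>sqrt (a * b)\<close>.\<close>
  moreover have "(X - b) * X > sqrt (a*b) * sqrt (a*b)"
    using X \<open>sqrt (a*b) \<ge> 0\<close> assms(3) by (intro mult_strict_mono') auto
  ultimately show False using assms(1) by (simp add: power2_eq_square algebra_simps)
qed

text \<open>A Harnack inequality, with \<open>D\<close> measuring the hyperbolic separation of the
  two points. For \<open>X\<close> the left side and \<open>a = Im (f w)\<close>, Schwarz-Pick gives
  \<open>X\<^sup>2 \<le> D * (X + a) * a\<close>, so \<open>X\<close> is at most \<open>a\<close> or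
  at most \<open>2 * D * a\<close>.\<close>

lemma nevanlinna_diff_le:
  assumes f: "nevanlinna f" and zw: "Im z > 0" "Im w > 0"
    and D: "(cmod (z - w))\<^sup>2 \<le> D * (Im z * Im w)"
  shows "cmod (f z - f w) \<le> (1 + 2 * D) * Im (f w)"
proof -
  define X a where "X = cmod (f z - f w)" and "a = Im (f w)"
  have a: "a \<ge> 0" and X: "X \<ge> 0" using nevanlinna_Im[OF f zw(2)] by (auto simp: a_def X_def)
  have D0: "D \<ge> 0" 
  proof -
    have "0 \<le> D * (Im z * Im w)" using D by (meson order_trans zero_le_power2)
    moreover have "Im z * Im w > 0" using zw by simp
    ultimately show ?thesis by (metis mult_neg_pos not_le)
  qed
  have "X\<^sup>2 * (Im z * Im w) \<le> (cmod (z - w))\<^sup>2 * (Im (f z) * a)"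
    unfolding X_def a_def by (rule Schwarz_Pick[OF f zw])
  also have "\<dots> \<le> (D * (Im z * Im w)) * (Im (f z) * a)"
    using D nevanlinna_Im[OF f zw(1)] a by (intro mult_right_mono) auto
  finally have "X\<^sup>2 \<le> D * Im (f z) * a" using zw by (simp add: algebra_simps)
  also have "\<dots> \<le> D * (X + a) * a"
  proof -
    have "Im (f z) \<le> X + a" unfolding X_def a_def
      using abs_Im_le_cmod[of "f z - f w"] by simp
    then show ?thesis using D0 a by (intro mult_right_mono mult_left_mono) auto
  qed
  finally have le: "X\<^sup>2 \<le> D * (X + a) * a" .
  show ?thesis
  proof (cases "X \<le> a")
    case True
    then show ?thesis using D0 a unfolding X_def[symmetric] a_def[symmetric] by (simp add: algebra_simps add_increasing2)
  next
    case False
    then have "D * (X + a) * a \<le> D * (2 * X) * a"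
      using D0 a by (intro mult_right_mono mult_left_mono) auto
    with le have "X * X \<le> (2 * D * a) * X" by (simp add: power2_eq_square algebra_simps)
    moreover have "X > 0" using False a by simp
    ultimately have "X \<le> 2 * D * a" by simp
    then show ?thesis unfolding X_def[symmetric] a_def[symmetric] using a by (simp add: algebra_simps)
  qed
qed

text \<open>The hyperbolic separation is bounded on \<open>K\<close> independently of
  \<open>f\<close>, so one \<open>C\<close> serves all Nevanlinna functions; this uniformity makes
  the difference quotients a normal family.\<close>

lemma Harnack_compact:
  assumes "compact K" "K \<subseteq> \<H>"
  obtains C where "C \<ge> 0"
    and "\<And>f z w. nevanlinna f \<Longrightarrow> z \<in> K \<Longrightarrow> w \<in> K \<Longrightarrow> cmod (f z - f w) \<le> C * Im (f w)"
proof -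
  have "continuous_on (K \<times> K) (\<lambda>(z,w). (cmod (z - w))\<^sup>2 / (Im z * Im w))"
    unfolding case_prod_unfold by (intro continuous_intros) (use assms in force)
  then have "compact ((\<lambda>(z,w). (cmod (z - w))\<^sup>2 / (Im z * Im w)) ` (K \<times> K))"
    using assms by (intro compact_continuous_image compact_Times)
  from compact_imp_bounded[OF this] obtain B where B: "B > 0" "\<And>x. x \<in> (\<lambda>(z,w). (cmod (z - w))\<^sup>2 / (Im z * Im w)) ` (K \<times> K) \<Longrightarrow> norm x \<le> B"
    unfolding bounded_pos by blast
  show ?thesis
  proof
    show "1 + 2 * B \<ge> 0" using B by simp
    fix f z w assume *: "nevanlinna f" "z \<in> K" "w \<in> K"
    then have i: "Im z > 0" "Im w > 0" using assms by auto
    have "norm ((cmod (z - w))\<^sup>2 / (Im z * Im w)) \<le> B" using * by (intro B) force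
    then have "(cmod (z - w))\<^sup>2 \<le> B * (Im z * Im w)" using i by (simp add: divide_le_eq abs_mult)
    then show "cmod (f z - f w) \<le> (1 + 2 * B) * Im (f w)"
      using nevanlinna_diff_le * i by blast
  qed
qed

text \<open>The Julia--Caratheodory theorem at \<open>\<infinity>\<close>; \<open>\<beta>\<close> is the infimum of \<open>Im (g z) / Im z\<close>.\<close>
lemma nevanlinna_angular_derivative:
  assumes g: "nevanlinna g"
  obtains \<beta> where "\<beta> \<ge> 0"
    and "\<And>m \<epsilon>. m > 0 \<Longrightarrow> \<epsilon> > 0 \<Longrightarrow>
          \<exists>R>0. \<forall>z. Im z \<ge> m * cmod z \<longrightarrow> cmod z \<ge> R \<longrightarrow> cmod (g z - of_real \<beta> * z) \<le> \<epsilon> * cmod z"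
proof -
  define \<beta> where "\<beta> = (INF z\<in>\<H>. Im (g z) / Im z)"
  have ne: "\<H> \<noteq> {}" using mem_upper_half_plane[of \<i>] by fastforce
  have bdd: "bdd_below ((\<lambda>z. Im (g z) / Im z) ` \<H>)"
    using nevanlinna_Im[OF g] by (intro bdd_belowI2[of _ 0]) auto
  have b0: "\<beta> \<ge> 0" unfolding \<beta>_def
    using nevanlinna_Im[OF g] ne by (intro cINF_greatest) auto
  \<comment> \<open>Without the linear term the infimum of \<open>Im (k z) / Im z\<close> is 0, and
    the claim becomes \<open>k z = o(z)\<close> in cones.\<close>
  define k where "k = (\<lambda>z. g z - of_real \<beta> * z)"
  have k: "nevanlinna k"
  proof (rule nevanlinnaI)
    show "k holomorphic_on \<H>" unfolding k_def
      using nevanlinna_holomorphic[OF g] by (intro holomorphic_intros)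
    fix z assume z: "Im z > 0"
    have "\<beta> \<le> Im (g z) / Im z" unfolding \<beta>_def using bdd z by (intro cINF_lower) auto
    then show "0 \<le> Im (k z)" using z by (simp add: k_def field_simps)
  qed
  have "\<exists>R>0. \<forall>z. Im z \<ge> m * cmod z \<longrightarrow> cmod z \<ge> R \<longrightarrow> cmod (k z) \<le> \<epsilon> * cmod z"
    if m: "m > 0" and e: "\<epsilon> > 0" for m \<epsilon>
  proof -
    \<comment> \<open>Chosen so that \<open>b\<close> below equals
      \<open>\<epsilon> * cmod z / 2\<close>.\<close>
    define \<delta> where "\<delta> = \<epsilon> * m / 8"
    have d: "\<delta> > 0" using m e by (simp add: \<delta>_def)
    \<comment> \<open>A near-minimiser makes \<open>Im (k z0)\<close> at most
      \<open>\<delta> * Im z0\<close>; Schwarz-Pick between \<open>z\<close> and \<open>z0\<close>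
      spreads this smallness over the cone.\<close>
    obtain z0 where z0: "Im z0 > 0" "Im (g z0) / Im z0 < \<beta> + \<delta>"
      using cINF_less_iff[OF ne bdd, of "\<beta> + \<delta>"] d unfolding \<beta>_def[symmetric] by auto
    define a where "a = Im (k z0)"
    have a: "a \<ge> 0" "a \<le> \<delta> * Im z0"
      using nevanlinna_Im[OF k z0(1)] z0 by (auto simp: a_def k_def field_simps)
    \<comment> \<open>The entries in order keep \<open>z\<close> away from 0, give
      \<open>|z - z0| \<le> 2 * |z|\<close>, and make \<open>cmod (k z0)\<close> and
      \<open>sqrt (a * b)\<close> at most \<open>\<epsilon> * cmod z / 8\<close>.\<close>
    define R where "R = Max {1, cmod z0, 8 * cmod (k z0) / \<epsilon>, 64 * a / (\<epsilon> * \<epsilon>) * (4 * \<delta> / m)}"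
    have R: "R \<ge> 1" "R \<ge> cmod z0" "R \<ge> 8 * cmod (k z0) / \<epsilon>" "R \<ge> 64 * a / (\<epsilon> * \<epsilon>) * (4 * \<delta> / m)"
      unfolding R_def by (rule Max_ge; simp)+
    have "cmod (k z) \<le> \<epsilon> * cmod z" if z: "Im z \<ge> m * cmod z" "cmod z \<ge> R" for z
    proof -
      have cz: "cmod z \<ge> 1" using z R by simp
      have Imz: "Im z > 0" using z cz m by (smt (verit) mult_pos_pos)
      define X where "X = cmod (k z - k z0)"
      define b where "b = \<delta> * (4 * cmod z / m)"
      have b: "b \<ge> 0" using d m by (simp add: b_def)
      have "cmod (z - z0) \<le> 2 * cmod z"
        using norm_triangle_ineq4[of z z0] R(2) z(2) by linarith
      then have "(cmod (z - z0))\<^sup>2 \<le> (2 * cmod z)\<^sup>2" by (intro power_mono) auto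
      also have "\<dots> = 4 * cmod z / m * (m * cmod z)" using m by (simp add: power2_eq_square)
      also have "\<dots> \<le> 4 * cmod z / m * Im z" using z m by (intro mult_left_mono) auto
      finally have zz: "(cmod (z - z0))\<^sup>2 \<le> 4 * cmod z / m * Im z" .
      have "X\<^sup>2 * (Im z * Im z0) \<le> (cmod (z - z0))\<^sup>2 * (Im (k z) * a)"
        unfolding X_def a_def by (rule Schwarz_Pick[OF k Imz z0(1)])
      also have "\<dots> \<le> (4 * cmod z / m * Im z) * (Im (k z) * (\<delta> * Im z0))"
        using zz a nevanlinna_Im[OF k Imz] m Imz by (intro mult_mono mult_left_mono) auto
      finally have "X\<^sup>2 * (Im z * Im z0) \<le> (Im (k z) * b) * (Im z * Im z0)" by (simp add: b_def algebra_simps)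
      then have "X\<^sup>2 \<le> Im (k z) * b" using Imz z0(1) by simp
      also have "\<dots> \<le> (X + a) * b"
        using abs_Im_le_cmod[of "k z - k z0"] b by (intro mult_right_mono) (auto simp: X_def a_def)
      finally have "X \<le> b + sqrt (a * b)" using a b by (intro square_le_imp_le) auto
      moreover have "b \<le> \<epsilon> * cmod z / 2" using m by (simp add: b_def \<delta>_def)
      moreover have "sqrt (a * b) \<le> \<epsilon> * cmod z / 8"
      proof (rule real_le_lsqrt)
        show "0 \<le> \<epsilon> * cmod z / 8" using e by simp
        have "64 * a / (\<epsilon> * \<epsilon>) * (4 * \<delta> / m) \<le> cmod z" using R(4) z(2) by linarith
        then have "a * (4 * \<delta> / m) \<le> cmod z * (\<epsilon> * \<epsilon> / 64)"
          using e m by (simp add: field_simps)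
        then have "a * (4 * \<delta> / m) * cmod z \<le> cmod z * (\<epsilon> * \<epsilon> / 64) * cmod z"
          by (intro mult_right_mono) auto
        then show "a * b \<le> (\<epsilon> * cmod z / 8)\<^sup>2"
          by (simp add: b_def power2_eq_square algebra_simps)
      qed
      moreover have "cmod (k z0) \<le> \<epsilon> * cmod z / 8"
      proof -
        have "8 * cmod (k z0) / \<epsilon> \<le> cmod z" using R(3) z(2) by linarith
        then show ?thesis using e by (simp add: field_simps)
      qed
      moreover have "cmod (k z) \<le> X + cmod (k z0)"
        unfolding X_def using norm_triangle_sub[of "k z" "k z0"] by simp
      moreover have "\<epsilon> * cmod z \<ge> 0" using e by simp
      ultimately show ?thesis by linarith
    qed
    then show ?thesis using R(1) by (intro exI[of _ R]) auto
  qed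
  then show ?thesis using that b0 unfolding k_def by blast
qed

section \<open>The infinitesimal generator\<close>

lemma angular_lim_infty_imaginary_axis:
  assumes "angular_lim_infty f L"
  shows "((\<lambda>R. f (\<i> * of_real R)) \<longlongrightarrow> L) at_top"
proof -
  have "filterlim (\<lambda>R. \<i> * of_real R :: complex) at_infinity at_top"
    using filterlim_at_infinity_imp_norm_at_top[OF filterlim_at_top_imp_at_infinity[OF filterlim_ident]]
    by (subst filterlim_at_infinity_conv_norm_at_top) (simp add: norm_mult)
  moreover have "\<forall>\<^sub>F R in at_top. \<i> * of_real R \<in> {z. Im z > 0 \<and> \<bar>Re z\<bar> \<le> 1 * Im z}"
    using eventually_gt_at_top[of 0] by eventually_elim auto
  ultimately have "filterlim (\<lambda>R. \<i> * of_real R)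
      (inf at_infinity (principal {z. Im z > 0 \<and> \<bar>Re z\<bar> \<le> 1 * Im z})) at_top"
    by (simp add: filterlim_inf filterlim_principal)
  moreover have "(f \<longlongrightarrow> L) (inf at_infinity (principal {z. Im z > 0 \<and> \<bar>Re z\<bar> \<le> 1 * Im z}))"
    using assms unfolding angular_lim_infty_def by (metis zero_less_one)
  ultimately show ?thesis by (rule filterlim_compose[rotated])
qed

text \<open>Julia's lemma at \<open>\<infinity>\<close>: Schwarz--Pick for the pair \<open>z\<close>, \<open>iR\<close>, divided by \<open>R\<^sup>2\<close>, as \<open>R \<rightarrow> \<infinity>\<close>.\<close>
lemma Julia_at_infinity:
  assumes f: "nevanlinna f" and lim: "angular_lim_infty (\<lambda>z. f z / z) 1" and z: "Im z > 0"
  shows "Im z \<le> Im (f z)"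
proof -
  define q where "q = (\<lambda>R::real. f (\<i> * of_real R) / (\<i> * of_real R))"
  have q: "(q \<longlongrightarrow> 1) at_top"
    unfolding q_def by (rule angular_lim_infty_imaginary_axis[OF lim])
  have inv: "((\<lambda>R::real. of_real (inverse R)::complex) \<longlongrightarrow> of_real 0) at_top"
    by (intro tendsto_intros tendsto_inverse_0_at_top filterlim_ident)
  have L: "((\<lambda>R. (cmod (f z * of_real (inverse R) - \<i> * q R))\<^sup>2 * Im z)
      \<longlongrightarrow> (cmod (f z * of_real 0 - \<i> * 1))\<^sup>2 * Im z) at_top"
    by (intro tendsto_intros q inv)
  have R: "((\<lambda>R. (cmod (z * of_real (inverse R) - \<i>))\<^sup>2 * (Im (f z) * Re (q R)))
      \<longlongrightarrow> (cmod (z * of_real 0 - \<i>))\<^sup>2 * (Im (f z) * Re 1)) at_top"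
    by (intro tendsto_intros q inv)
  have "\<forall>\<^sub>F R in at_top. (cmod (f z * of_real (inverse R) - \<i> * q R))\<^sup>2 * Im z
      \<le> (cmod (z * of_real (inverse R) - \<i>))\<^sup>2 * (Im (f z) * Re (q R))"
    using eventually_gt_at_top[of 0]
  proof eventually_elim
    case (elim R)
    define w where "w = \<i> * complex_of_real R"
    have w: "Im w = R" "Im w > 0" "w \<noteq> 0" using elim by (auto simp: w_def)
    have fw: "f w = w * q R" using w by (simp add: q_def w_def)
    have a: "f z - f w = of_real R * (f z * of_real (inverse R) - \<i> * q R)"
      unfolding fw using elim by (simp add: w_def field_simps)
    have b: "z - w = of_real R * (z * of_real (inverse R) - \<i>)"
      using elim by (simp add: w_def field_simps)
    have c: "Im (f w) = R * Re (q R)" unfolding fw by (simp add: w_def)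
    have "(cmod (f z - f w))\<^sup>2 * (Im z * Im w) \<le> (cmod (z - w))\<^sup>2 * (Im (f z) * Im (f w))"
      by (rule Schwarz_Pick[OF f z w(2)])
    \<comment> \<open>The squares contribute \<open>R\<^sup>2\<close>, and \<open>Im w\<close> on
      the left and \<open>Im (f w)\<close> on the right one more \<open>R\<close>.\<close>
    then have "R ^ 3 * ((cmod (f z * of_real (inverse R) - \<i> * q R))\<^sup>2 * Im z) \<le>
      R ^ 3 * ((cmod (z * of_real (inverse R) - \<i>))\<^sup>2 * (Im (f z) * Re (q R)))"
      unfolding a b c w(1) norm_mult norm_of_real power_mult_distrib using elim
      by (simp add: power2_eq_square power3_eq_cube algebra_simps)
    then show ?case using elim by simp
  qed
  from tendsto_le[OF _ R L this] show ?thesis by simp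
qed

section \<open>Monotone imaginary parts and continuity of orbits\<close>

locale parabolic_semigroup =
  fixes \<phi> :: "real \<Rightarrow> complex \<Rightarrow> complex"
  assumes semigroup: "semigroup_H \<phi>"
    and parabolic: "parabolic_H \<phi>"
begin

lemma nevanlinna_flow: "t \<ge> 0 \<Longrightarrow> nevanlinna (\<phi> t)"
  using semigroup unfolding semigroup_H_def nevanlinna_def image_subset_iff by (auto intro: less_imp_le)

lemma Im_flow_pos [simp]: "t \<ge> 0 \<Longrightarrow> Im z > 0 \<Longrightarrow> Im (\<phi> t z) > 0"
  using semigroup unfolding semigroup_H_def image_subset_iff by auto

lemma flow_0 [simp]: "Im z > 0 \<Longrightarrow> \<phi> 0 z = z"
  using semigroup unfolding semigroup_H_def by auto

lemma flow_add: "s \<ge> 0 \<Longrightarrow> t \<ge> 0 \<Longrightarrow> Im z > 0 \<Longrightarrow> \<phi> (t + s) z = \<phi> t (\<phi> s z)"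
  using semigroup unfolding semigroup_H_def by auto

lemma flow_at_0: "Im z > 0 \<Longrightarrow> ((\<lambda>t. \<phi> t z) \<longlongrightarrow> z) (at_right 0)"
  using semigroup unfolding semigroup_H_def by auto

lemma Im_flow_ge: "t \<ge> 0 \<Longrightarrow> Im z > 0 \<Longrightarrow> Im z \<le> Im (\<phi> t z)"
  using Julia_at_infinity nevanlinna_flow parabolic unfolding parabolic_H_def by blast

lemma Im_flow_mono: 
  assumes "0 \<le> s" "s \<le> t" "Im z > 0" shows "Im (\<phi> s z) \<le> Im (\<phi> t z)"
proof -
  have "\<phi> t z = \<phi> (t - s) (\<phi> s z)" using flow_add[of s "t - s" z] assms by simp
  then show ?thesis using Im_flow_ge[of "t - s" "\<phi> s z"] assms by simp
qed

text \<open>\<open>\<phi> s\<close> carries the pair \<open>\<phi> (t - s) z\<close>,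
  \<open>z\<close> to \<open>\<phi> t z\<close>, \<open>\<phi> s z\<close>, so Schwarz-Pick bounds a
  later increment by the increment from time 0. By monotonicity the factor depends only on
  \<open>z\<close> and the horizon \<open>T\<close>.\<close>

lemma flow_diff_le:
  assumes st: "0 \<le> s" "s \<le> t" "t \<le> T" and z: "Im z > 0"
  shows "cmod (\<phi> t z - \<phi> s z) \<le> cmod (\<phi> (t - s) z - z) * Im (\<phi> T z) / Im z"
proof -
  define u where "u = \<phi> (t - s) z"
  have u: "Im u \<ge> Im z" using Im_flow_ge st z by (simp add: u_def)
  have "\<phi> t z = \<phi> s u" using flow_add[of "t - s" s z] st z by (simp add: u_def)
  have "(cmod (\<phi> s u - \<phi> s z))\<^sup>2 * (Im z * Im z) \<le> (cmod (\<phi> s u - \<phi> s z))\<^sup>2 * (Im u * Im z)"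
    using u z by (intro mult_left_mono mult_right_mono) auto
  also have "\<dots> \<le> (cmod (u - z))\<^sup>2 * (Im (\<phi> s u) * Im (\<phi> s z))"
    using Schwarz_Pick[OF nevanlinna_flow[OF st(1)]] u z by simp
  also have "\<dots> \<le> (cmod (u - z))\<^sup>2 * (Im (\<phi> T z) * Im (\<phi> T z))"
  proof (intro mult_left_mono mult_mono)
    show "Im (\<phi> s u) \<le> Im (\<phi> T z)" 
      unfolding \<open>\<phi> t z = \<phi> s u\<close>[symmetric] using Im_flow_mono[of t T z] st z by simp
    show "Im (\<phi> s z) \<le> Im (\<phi> T z)" using Im_flow_mono[of s T z] st z by simp
    show "0 \<le> Im (\<phi> T z)" "0 \<le> Im (\<phi> s z)" using Im_flow_pos st z by (meson less_imp_le order_trans)+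
  qed auto
  finally have "(cmod (\<phi> s u - \<phi> s z) * Im z)\<^sup>2 \<le> (cmod (u - z) * Im (\<phi> T z))\<^sup>2"
    by (simp add: power2_eq_square algebra_simps)
  moreover have "0 \<le> cmod (u - z) * Im (\<phi> T z)"
    using Im_flow_pos[OF order_trans[OF st(1) order_trans[OF st(2,3)]] z] by (intro mult_nonneg_nonneg) auto
  ultimately have "cmod (\<phi> s u - \<phi> s z) * Im z \<le> cmod (u - z) * Im (\<phi> T z)"
    using power2_le_imp_le by blast
  then show ?thesis using z unfolding \<open>\<phi> t z = \<phi> s u\<close> u_def by (simp add: field_simps)
qed

text \<open>Right continuity at time 0 is transferred to both sides of every \<open>t\<close> by
  bounding each increment by the increment from 0.\<close>

lemma continuous_flow:
  assumes z: "Im z > 0"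
  shows "continuous_on {0..} (\<lambda>t. \<phi> t z)"
  unfolding continuous_on_iff
proof (intro ballI allI impI)
  fix t e :: real assume t: "t \<in> {0..}" and e: "e > 0"
  define M where "M = Im (\<phi> (t + 1) z) / Im z"
  have M: "M > 0" using t z by (simp add: M_def)
  have "\<forall>\<^sub>F s in at_right 0. dist (\<phi> s z) z < e / M"
    using tendstoD[OF flow_at_0[OF z], of "e / M"] e M by simp
  then obtain b where b: "b > 0" "\<And>s. 0 < s \<Longrightarrow> s < b \<Longrightarrow> dist (\<phi> s z) z < e / M"
    unfolding eventually_at_right_field by auto
  have small: "cmod (\<phi> s' z - \<phi> s z) < e" if "0 \<le> s" "s \<le> s'" "s' - s < b" "s' \<le> t + 1" for s s'
  proof (cases "s = s'")
    case False
    then have "cmod (\<phi> (s' - s) z - z) < e / M" using b(2)[of "s' - s"] that by (simp add: dist_norm)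
    then have "cmod (\<phi> (s' - s) z - z) * M < e" using M by (simp add: field_simps)
    moreover have "cmod (\<phi> s' z - \<phi> s z) \<le> cmod (\<phi> (s' - s) z - z) * M"
      using flow_diff_le[of s s' "t + 1" z] that z by (simp add: M_def)
    ultimately show ?thesis by linarith
  qed (use e in simp)
  \<comment> \<open>The cap 1 in \<open>min b 1\<close> keeps \<open>s\<close> below
    \<open>t + 1\<close>, where \<open>M\<close> is a valid factor.\<close>
  show "\<exists>d>0. \<forall>s\<in>{0..}. dist s t < d \<longrightarrow> dist (\<phi> s z) (\<phi> t z) < e"
  proof (intro exI[of _ "min b 1"] conjI ballI impI)
    fix s assume "s \<in> {0..}" "dist s t < min b 1"
    then show "dist (\<phi> s z) (\<phi> t z) < e"
      using small[of s t] small[of t s] t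
      by (cases "s \<le> t") (auto simp: dist_norm norm_minus_commute abs_if split: if_splits)
  qed (use b in simp)
qed

lemma compact_orbit:
  assumes "Im z > 0"
  shows "compact ((\<lambda>t. \<phi> t z) ` {0..T})" and "(\<lambda>t. \<phi> t z) ` {0..T} \<subseteq> \<H>"
  using assms by (auto intro!: compact_continuous_image continuous_on_subset[OF continuous_flow])

text \<open>The steps \<open>1 / Suc N\<close> are never degenerate and divide the unit interval
  exactly, so orbit increments telescope from 0 to 1.\<close>

definition diff_quot :: "nat \<Rightarrow> complex \<Rightarrow> complex" where
  "diff_quot N z = of_nat (Suc N) * (\<phi> (1 / real (Suc N)) z - z)"

text \<open>Julia's lemma, in the form \<open>Im_flow_ge\<close>, says that orbit increments have
  nonnegative imaginary part.\<close>

lemma nevanlinna_diff_quot: "nevanlinna (diff_quot N)"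
proof (rule nevanlinnaI)
  show "diff_quot N holomorphic_on \<H>"
    unfolding diff_quot_def using nevanlinna_holomorphic[OF nevanlinna_flow]
    by (intro holomorphic_intros) auto
  fix z assume "Im z > 0"
  then show "Im (diff_quot N z) \<ge> 0"
    using Im_flow_ge[of "1 / real (Suc N)" z] by (simp add: diff_quot_def del: of_nat_Suc)
qed

lemma flow_step: 
  assumes "s \<ge> 0" "Im z > 0"
  shows "\<phi> (s + 1 / real (Suc N)) z - \<phi> s z = diff_quot N (\<phi> s z) / of_nat (Suc N)"
  using flow_add[of s "1 / real (Suc N)" z] assms
  by (simp add: diff_quot_def add.commute del: of_nat_Suc)

text \<open>Each summand is \<open>Suc N\<close> times the orbit increment over one mesh interval,
  so the sum telescopes.\<close>

lemma sum_diff_quot: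
  assumes z: "Im z > 0"
  shows "(\<Sum>k<Suc N. diff_quot N (\<phi> (real k / real (Suc N)) z)) = of_nat (Suc N) * (\<phi> 1 z - z)"
proof -
  have "(\<Sum>k<n. diff_quot N (\<phi> (real k / real (Suc N)) z))
      = of_nat (Suc N) * (\<phi> (real n / real (Suc N)) z - z)" for n
  proof (induction n)
    case (Suc n)
    have "real n / real (Suc N) + 1 / real (Suc N) = real (Suc n) / real (Suc N)"
      by (metis add.commute add_divide_distrib of_nat_Suc)
    then have "\<phi> (real (Suc n) / real (Suc N)) z - \<phi> (real n / real (Suc N)) z
        = diff_quot N (\<phi> (real n / real (Suc N)) z) / of_nat (Suc N)"
      using flow_step[of "real n / real (Suc N)" z N] z by (metis divide_nonneg_nonneg of_nat_0_le_iff)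
    then have "diff_quot N (\<phi> (real n / real (Suc N)) z)
        = of_nat (Suc N) * (\<phi> (real (Suc n) / real (Suc N)) z - \<phi> (real n / real (Suc N)) z)"
      by (simp add: field_simps del: of_nat_Suc)
    then show ?case
      unfolding sum.lessThan_Suc Suc.IH by (simp only:) (simp add: algebra_simps del: of_nat_Suc)
  qed (use z in simp)
  from this[of "Suc N"] show ?thesis by (simp del: of_nat_Suc)
qed

text \<open>The imaginary parts of the difference quotients along the orbit of \<open>\<i>\<close> are nonnegative and average
  to \<open>Im (\<phi> 1 \<i>) - 1\<close>, so Harnack bounds each of them and also their real parts.\<close>
lemma diff_quot_bounded:
  obtains B where "\<And>N. cmod (diff_quot N \<i>) \<le> B"
proof -
  define K where "K = (\<lambda>t. \<phi> t \<i>) ` {0..1}"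
  have K: "compact K" "K \<subseteq> \<H>" using compact_orbit[of \<i> 1] by (auto simp: K_def)
  obtain C where C: "C \<ge> 0"
    "\<And>f z w. nevanlinna f \<Longrightarrow> z \<in> K \<Longrightarrow> w \<in> K \<Longrightarrow> cmod (f z - f w) \<le> C * Im (f w)"
    using Harnack_compact[OF K] by blast
  define v where "v = \<phi> 1 \<i> - \<i>"
  have "cmod (diff_quot N \<i>) \<le> cmod v + C * ((1 + C) * Im v)" for N
  proof -
    let ?q = "diff_quot N" and ?w = "\<lambda>k. \<phi> (real k / real (Suc N)) \<i>"
    have iK: "\<i> \<in> K" unfolding K_def by (rule image_eqI[of _ _ 0]) auto
    have wK: "?w k \<in> K" if "k < Suc N" for k
      unfolding K_def using that by (intro imageI) auto
    have sum: "(\<Sum>k<Suc N. ?q (?w k)) = of_nat (Suc N) * v"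
      unfolding v_def by (rule sum_diff_quot) simp
    have "Im (?q \<i>) \<le> (1 + C) * Im (?q (?w k))" if "k < Suc N" for k
    proof -
      have "cmod (?q \<i> - ?q (?w k)) \<le> C * Im (?q (?w k))"
        using C(2)[OF nevanlinna_diff_quot iK wK[OF that]] .
      then show ?thesis using abs_Im_le_cmod[of "?q \<i> - ?q (?w k)"] by (simp add: algebra_simps)
    qed
    then have "(\<Sum>k<Suc N. Im (?q \<i>)) \<le> (\<Sum>k<Suc N. (1 + C) * Im (?q (?w k)))"
      by (intro sum_mono) auto
    also have "\<dots> = (1 + C) * Im (\<Sum>k<Suc N. ?q (?w k))"
      by (simp only: sum_distrib_left Im_sum)
    also have "\<dots> = real (Suc N) * ((1 + C) * Im v)"
      unfolding sum by (simp del: of_nat_Suc)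
    finally have Im: "Im (?q \<i>) \<le> (1 + C) * Im v"
      by (simp del: of_nat_Suc)
    \<comment> \<open>\<open>v\<close> is the mean of the quotients along the mesh, so its distance
      to the value at \<open>\<i>\<close> is at most a mean of Harnack deviations.\<close>
    have "of_nat (Suc N) * (v - ?q \<i>) = (\<Sum>k<Suc N. ?q (?w k) - ?q \<i>)"
      unfolding sum_subtractf sum by (simp add: algebra_simps)
    then have "real (Suc N) * cmod (v - ?q \<i>) = cmod (\<Sum>k<Suc N. ?q (?w k) - ?q \<i>)"
      by (metis norm_mult norm_of_nat)
    also have "\<dots> \<le> of_nat (card {..<Suc N}) * (C * Im (?q \<i>))"
      using C(2)[OF nevanlinna_diff_quot wK iK] by (intro sum_norm_bound) auto
    finally have "cmod (v - ?q \<i>) \<le> C * Im (?q \<i>)" by (simp del: of_nat_Suc)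
    also have "\<dots> \<le> C * ((1 + C) * Im v)" using Im C(1) by (intro mult_left_mono) auto
    finally show ?thesis using norm_triangle_sub[of "?q \<i>" v] by (simp add: norm_minus_commute)
  qed
  then show ?thesis using that by blast
qed

text \<open>Harnack and Montel give a locally uniform subsequential limit \<open>G\<close>.
  Comparing orbit increments over steps \<open>1 / Suc (r n)\<close> with integrals of
  \<open>G\<close> proves the integral equation; a subsequence suffices because its mesh still tends
  to 0.\<close>

theorem generator_exists:
  obtains G where "nevanlinna G"
    and "\<And>z t. Im z > 0 \<Longrightarrow> t \<ge> 0 \<Longrightarrow> ((\<lambda>t. \<phi> t z) has_vector_derivative G (\<phi> t z)) (at t within {0..})"
proof -
  obtain B where B: "\<And>N. cmod (diff_quot N \<i>) \<le> B" using diff_quot_bounded by blast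
  obtain G r where G: "G holomorphic_on \<H>" and r: "strict_mono (r :: nat \<Rightarrow> nat)"
    and ptw: "\<And>x. x \<in> \<H> \<Longrightarrow> ((\<lambda>n. diff_quot (r n) x) \<longlongrightarrow> G x) sequentially"
    and unif: "\<And>K. \<lbrakk>compact K; K \<subseteq> \<H>\<rbrakk> \<Longrightarrow> uniform_limit K (diff_quot \<circ> r) G sequentially"
  proof (rule Montel[of \<H> "range diff_quot" diff_quot])
    \<comment> \<open>Adjoining \<open>\<i>\<close> to \<open>K\<close> lets Harnack carry the bound
      \<open>B\<close> at \<open>\<i>\<close> over to \<open>K\<close>.\<close>
    fix K assume K: "compact K" "K \<subseteq> \<H>"
    then have "compact (insert \<i> K)" "insert \<i> K \<subseteq> \<H>" by auto
    from Harnack_compact[OF this] obtain C where C: "C \<ge> 0"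
      "\<And>f z w. nevanlinna f \<Longrightarrow> z \<in> insert \<i> K \<Longrightarrow> w \<in> insert \<i> K \<Longrightarrow> cmod (f z - f w) \<le> C * Im (f w)"
      by metis
    have "cmod (diff_quot N z) \<le> B + C * B" if "z \<in> K" for N z
    proof -
      have "cmod (diff_quot N z - diff_quot N \<i>) \<le> C * Im (diff_quot N \<i>)"
        using C(2)[OF nevanlinna_diff_quot, of z \<i>] that by simp
      also have "\<dots> \<le> C * B"
        using C(1) B[of N] abs_Im_le_cmod[of "diff_quot N \<i>"] by (intro mult_left_mono) linarith+
      finally show ?thesis
        using B[of N] norm_triangle_sub[of "diff_quot N z" "diff_quot N \<i>"] by linarith
    qed
    then show "\<exists>B. \<forall>h\<in>range diff_quot. \<forall>z\<in>K. cmod (h z) \<le> B" by blast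
  qed (use open_upper_half_plane nevanlinna_holomorphic[OF nevanlinna_diff_quot] in auto)
  have nG: "nevanlinna G"
  proof (rule nevanlinnaI[OF G])
    fix z assume z: "Im z > 0"
    have "(\<lambda>n. Im (diff_quot (r n) z)) \<longlonglongrightarrow> Im (G z)" using ptw z by (intro tendsto_intros) simp
    then show "Im (G z) \<ge> 0"
      using nevanlinna_Im[OF nevanlinna_diff_quot z] by (intro tendsto_lowerbound) auto
  qed
  have contG: "continuous_on {0..} (\<lambda>s. G (\<phi> s z))" if z: "Im z > 0" for z
  proof -
    have "continuous_on ((\<lambda>s. \<phi> s z) ` {0..}) G"
      using z by (intro continuous_on_subset[OF holomorphic_on_imp_continuous_on[OF G]]) auto
    from continuous_on_compose[OF continuous_flow[OF z] this] show ?thesis by (simp add: o_def)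
  qed
  have integral_eq: "\<phi> T z - z = integral {0..T} (\<lambda>s. G (\<phi> s z))" if z: "Im z > 0" and T: "T \<ge> 0" for z T
  proof -
    \<comment> \<open>\<open>E\<close> is the defect in the integral equation. For fine meshes it
      changes by at most \<open>\<epsilon> * h\<close> per step, hence by at most
      \<open>T * \<epsilon>\<close> up to \<open>T\<close>.\<close>
    define E where "E = (\<lambda>t. \<phi> t z - z - integral {0..t} (\<lambda>s. G (\<phi> s z)))"
    have int: "(\<lambda>s. G (\<phi> s z)) integrable_on {a..b}" if "a \<ge> 0" for a b
      using that by (intro integrable_continuous_real continuous_on_subset[OF contG[OF z]]) auto
    have contE: "continuous_on {0..T} E"
      unfolding E_def
      by (intro continuous_intros continuous_on_subset[OF continuous_flow[OF z]] indefinite_integral_continuous_1 int) auto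
    define K where "K = (\<lambda>t. \<phi> t z) ` {0..T+1}"
    have K: "compact K" "K \<subseteq> \<H>" using compact_orbit[OF z, of "T+1"] by (auto simp: K_def)
    have "cmod (E T) \<le> T * \<epsilon>" if e: "\<epsilon> > 0" for \<epsilon>
    proof -
      \<comment> \<open>The extra unit of time accommodates a step \<open>h < 1\<close> that starts
        at or before \<open>T\<close>.\<close>
      have "uniformly_continuous_on {0..T+1} (\<lambda>s. G (\<phi> s z))"
        by (intro compact_uniformly_continuous continuous_on_subset[OF contG[OF z]]) auto
      then obtain d where d: "d > 0" and dG: "\<And>s s'. s \<in> {0..T+1} \<Longrightarrow> s' \<in> {0..T+1} \<Longrightarrow> dist s' s < d
          \<Longrightarrow> dist (G (\<phi> s' z)) (G (\<phi> s z)) < \<epsilon> / 2"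
        unfolding uniformly_continuous_on_def using e by (meson half_gt_zero)
      have "(\<lambda>n. 1 / real (Suc (r n))) \<longlonglongrightarrow> 0"
        using LIMSEQ_subseq_LIMSEQ[OF LIMSEQ_inverse_real_of_nat r] by (simp add: o_def inverse_eq_divide)
      then have ev1: "\<forall>\<^sub>F n in sequentially. 1 / real (Suc (r n)) < min d 1"
        using d by (intro order_tendstoD) auto
      have ev2: "\<forall>\<^sub>F n in sequentially. \<forall>x\<in>K. dist (diff_quot (r n) x) (G x) < \<epsilon> / 2"
        using uniform_limitD[OF unif[OF K], of "\<epsilon>/2"] e by simp
      \<comment> \<open>\<open>E\<close> is estimated at the last mesh point not exceeding
        \<open>T\<close>; these points converge to \<open>T\<close>, and \<open>E\<close> is
        continuous.\<close>
      have "\<forall>\<^sub>F n in sequentially. cmod (E (real (nat \<lfloor>T * real (Suc (r n))\<rfloor>) / real (Suc (r n)))) \<le> T * \<epsilon>"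
        using ev1 ev2
      proof eventually_elim
        case (elim n)
        define h where "h = 1 / real (Suc (r n))"
        have h: "h > 0" "h < d" "h < 1" using elim(1) by (auto simp: h_def)
        have step: "cmod (E (s + h) - E s) \<le> \<epsilon> * h" if s: "0 \<le> s" "s \<le> T" for s
        proof -
          have "integral {0..s+h} (\<lambda>s. G (\<phi> s z)) = integral {0..s} (\<lambda>s. G (\<phi> s z)) + integral {s..s+h} (\<lambda>s. G (\<phi> s z))"
            using Henstock_Kurzweil_Integration.integral_combine[of 0 s "s+h" "\<lambda>s. G (\<phi> s z)"] int[of 0] s h by simp
          then have "E (s + h) - E s = \<phi> (s + h) z - \<phi> s z - integral {s..s+h} (\<lambda>s. G (\<phi> s z))"
            by (simp add: E_def)
          \<comment> \<open>As an integral of a constant, the increment combines with the integral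
            of \<open>G\<close>; the errors from quotient to \<open>G\<close> and from time
            \<open>s\<close> to \<open>u\<close> are each below
            \<open>\<epsilon> / 2\<close>.\<close>
          also have "\<phi> (s + h) z - \<phi> s z = integral {s..s+h} (\<lambda>_. diff_quot (r n) (\<phi> s z))"
            using flow_step[of s z "r n"] s z h by (simp add: h_def scaleR_conv_of_real)
          finally have "E (s + h) - E s = integral {s..s+h} (\<lambda>u. diff_quot (r n) (\<phi> s z) - G (\<phi> u z))"
            using int[of s "s+h"] s by (subst Henstock_Kurzweil_Integration.integral_diff) auto
          moreover have "cmod (integral {s..s+h} (\<lambda>u. diff_quot (r n) (\<phi> s z) - G (\<phi> u z))) \<le> \<epsilon> * (s + h - s)"
          proof (rule integral_bound)
            show "continuous_on {s..s + h} (\<lambda>u. diff_quot (r n) (\<phi> s z) - G (\<phi> u z))"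
              using s by (intro continuous_intros continuous_on_subset[OF contG[OF z]]) auto
            fix u assume u: "u \<in> {s..s+h}"
            have "dist (G (\<phi> s z)) (G (\<phi> u z)) < \<epsilon> / 2"
              using u s h by (intro dG) (auto simp: dist_real_def)
            moreover have "dist (diff_quot (r n) (\<phi> s z)) (G (\<phi> s z)) < \<epsilon> / 2"
              using elim(2) s by (auto simp: K_def)
            ultimately show "cmod (diff_quot (r n) (\<phi> s z) - G (\<phi> u z)) \<le> \<epsilon>"
              using dist_triangle[of "diff_quot (r n) (\<phi> s z)" "G (\<phi> u z)" "G (\<phi> s z)"]
              by (simp add: dist_norm)
          qed (use h in auto)
          ultimately show ?thesis by simp
        qed
        have bound: "cmod (E (real k * h)) \<le> real k * (\<epsilon> * h)" if "real k * h \<le> T" for k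
          using that
        proof (induction k)
          case 0
          then show ?case using z by (simp add: E_def)
        next
          case (Suc k)
          have kh: "real k * h \<le> T" using Suc.prems h by (simp add: algebra_simps)
          have "cmod (E (real k * h + h)) \<le> cmod (E (real k * h)) + cmod (E (real k * h + h) - E (real k * h))"
            by (rule norm_triangle_sub)
          also have "\<dots> \<le> real k * (\<epsilon> * h) + \<epsilon> * h"
            using Suc.IH[OF kh] step[of "real k * h"] kh h by (intro add_mono) auto
          finally show ?case by (simp add: algebra_simps)
        qed
        define k where "k = nat \<lfloor>T * real (Suc (r n))\<rfloor>"
        have "real k \<le> T * real (Suc (r n))" using T by (simp add: k_def del: of_nat_Suc)
        then have kT: "real k * h \<le> T" by (simp add: h_def field_simps)
        have "cmod (E (real k * h)) \<le> real k * (\<epsilon> * h)" by (rule bound[OF kT])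
        also have "\<dots> = (real k * h) * \<epsilon>" by simp
        also have "\<dots> \<le> T * \<epsilon>" using kT e by (intro mult_right_mono) auto
        finally show ?case by (simp add: k_def h_def del: of_nat_Suc)
      qed
      moreover have "(\<lambda>n. E (real (nat \<lfloor>T * real (Suc (r n))\<rfloor>) / real (Suc (r n)))) \<longlonglongrightarrow> E T"
      proof (rule continuous_on_tendsto_compose[OF contE])
        have lim0: "(\<lambda>n. T - 1 / real (Suc (r n))) \<longlonglongrightarrow> T - 0"
          by (intro tendsto_diff tendsto_const) fact
        have fl: "real (nat \<lfloor>T * real (Suc m)\<rfloor>) \<le> T * real (Suc m)"
          "real (nat \<lfloor>T * real (Suc m)\<rfloor>) \<ge> T * real (Suc m) - 1" for m
          using T by (simp_all add: of_nat_nat del: of_nat_Suc)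
        have up: "real (nat \<lfloor>T * real (Suc m)\<rfloor>) / real (Suc m) \<le> T"
          and lo: "T - 1 / real (Suc m) \<le> real (nat \<lfloor>T * real (Suc m)\<rfloor>) / real (Suc m)" for m
          using fl(1)[of m] divide_right_mono[OF fl(2)[of m], of "real (Suc m)"]
          by (simp_all add: pos_divide_le_eq diff_divide_distrib del: of_nat_Suc)
        show "(\<lambda>n. real (nat \<lfloor>T * real (Suc (r n))\<rfloor>) / real (Suc (r n))) \<longlonglongrightarrow> T"
        proof (rule tendsto_sandwich)
          show "(\<lambda>n. T - 1 / real (Suc (r n))) \<longlonglongrightarrow> T" using lim0 by simp
          show "\<forall>\<^sub>F n in sequentially. T - 1 / real (Suc (r n)) \<le> real (nat \<lfloor>T * real (Suc (r n))\<rfloor>) / real (Suc (r n))"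
            by (intro always_eventually allI lo)
          show "\<forall>\<^sub>F n in sequentially. real (nat \<lfloor>T * real (Suc (r n))\<rfloor>) / real (Suc (r n)) \<le> T"
            by (intro always_eventually allI up)
        qed simp
        show "\<forall>\<^sub>F n in sequentially. real (nat \<lfloor>T * real (Suc (r n))\<rfloor>) / real (Suc (r n)) \<in> {0..T}"
          unfolding atLeastAtMost_iff by (intro always_eventually allI conjI up) simp
      qed (use T in auto)
      ultimately show ?thesis
        using tendsto_upperbound[OF tendsto_norm] by fastforce
    qed
    then have "\<forall>\<^sub>F \<epsilon> in at_right 0. cmod (E T) \<le> T * \<epsilon>"
      by (auto simp: eventually_at_right_less intro: eventually_mono[OF eventually_at_right_less])
    moreover have "((\<lambda>\<epsilon>. T * \<epsilon>) \<longlongrightarrow> T * 0) (at_right 0)" by (intro tendsto_intros)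
    ultimately have "cmod (E T) \<le> T * 0"
      using tendsto_lowerbound by fastforce
    then show ?thesis by (simp add: E_def)
  qed
  have "((\<lambda>t. \<phi> t z) has_vector_derivative G (\<phi> t z)) (at t within {0..})"
    if z: "Im z > 0" and t: "t \<ge> 0" for z t
  proof -
    have "((\<lambda>u. z + integral {0..u} (\<lambda>s. G (\<phi> s z))) has_vector_derivative G (\<phi> t z)) (at t within {0..t+1})"
      using integral_has_vector_derivative[of 0 "t+1" "\<lambda>s. G (\<phi> s z)" t] t
        continuous_on_subset[OF contG[OF z], of "{0..t+1}"]
      by (auto simp: has_vector_derivative_const intro!: derivative_eq_intros)
    then have "((\<lambda>t. \<phi> t z) has_vector_derivative G (\<phi> t z)) (at t within {0..t+1})"
      by (rule has_vector_derivative_transform[rotated 2]) (use t integral_eq[OF z] in \<open>auto simp: algebra_simps\<close>)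
    moreover have "at t within {0..t+1} = at t within {0..}"
      by (rule at_within_nhd[of _ "{..<t+1}"]) auto
    ultimately show ?thesis by simp
  qed
  then show ?thesis using that nG by blast
qed

end

section \<open>Orbits with square root growth\<close>

lemma cos_ge_half:
  assumes "\<bar>x\<bar> \<le> (1::real)"
  shows "cos x \<ge> 1 / 2"
proof -
  have "cos (pi / 3) \<le> cos \<bar>x\<bar>"
    using assms pi_gt3 by (intro cos_monotone_0_pi_le) auto
  then show ?thesis by (simp add: cos_60)
qed

text \<open>\<open>exp k\<close> will be the ratio of two velocities. The bound 1 limits its
  turning, as 1 is below pi/3, while the separate \<open>r\<close> records the loss in
  modulus.\<close>

lemma Re_exp_ge:
  assumes "cmod k \<le> 1" "cmod k \<le> r"
  shows "Re (exp k) \<ge> exp (- r) / 2"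
proof -
  have "\<bar>Im k\<bar> \<le> 1" "- r \<le> Re k"
    using assms abs_Im_le_cmod[of k] abs_Re_le_cmod[of k] by linarith+
  then have "exp (Re k) * cos (Im k) \<ge> exp (- r) * (1 / 2)"
    using cos_ge_half by (intro mult_mono) auto
  then show ?thesis by (simp add: Re_exp)
qed

section \<open>Integral curves of a zero-free Nevanlinna field\<close>

locale nevanlinna_orbit =
  fixes G :: "complex \<Rightarrow> complex" and w :: "real \<Rightarrow> complex"
  assumes nevanlinna: "nevanlinna G"
    and nonzero: "Im z > 0 \<Longrightarrow> G z \<noteq> 0"
    and Im_pos: "t \<ge> 0 \<Longrightarrow> Im (w t) > 0"
    and orbit: "t \<ge> 0 \<Longrightarrow> (w has_vector_derivative G (w t)) (at t within {0..})"
begin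

lemma continuous_on_orbit: "continuous_on {0..} w"
  using orbit by (intro continuous_on_vector_derivative) auto

lemma has_vector_derivative_orbit_compose:
  assumes "t \<ge> 0" and f: "f holomorphic_on \<H>"
  shows "((\<lambda>t. f (w t)) has_vector_derivative G (w t) * deriv f (w t)) (at t within {0..})"
proof -
  have "(f has_field_derivative deriv f (w t)) (at (w t))"
    using assms Im_pos open_upper_half_plane by (intro holomorphic_derivI[OF f]) auto
  then have "(f has_field_derivative deriv f (w t)) (at (w t) within w ` {0..})"
    by (rule has_field_derivative_at_within)
  from field_vector_diff_chain_within[OF orbit[OF assms(1)] this] show ?thesis by (simp add: o_def)
qed

lemma at_within_nonneg: "t > 0 \<Longrightarrow> at t within {0..} = at (t::real)"
  by (rule at_within_interior) (simp add: interior_real_atLeast)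

lemma Im_orbit_derivative:
  assumes "t \<ge> 0"
  shows "((\<lambda>t. Im (w t)) has_real_derivative Im (G (w t))) (at t within {0..})"
  using bounded_linear.has_vector_derivative[OF bounded_linear_Im orbit[OF assms]]
  by (simp add: has_real_derivative_iff_has_vector_derivative)

text \<open>One estimate for both the turning of the velocity (imaginary part of \<open>l\<close>)
  and its change of speed (real part) in terms of the growth of the height.\<close>

lemma log_variation:
  assumes l: "l holomorphic_on \<H>" "\<And>z. z \<in> \<H> \<Longrightarrow> exp (l z) = G z" and st: "0 \<le> s" "s \<le> t"
  shows "cmod (l (w t) - l (w s)) \<le> ln (Im (w t)) - ln (Im (w s))"
proof (cases "s = t")
  case False
  show ?thesis
  proof (rule differentiable_bound_general[where f' = "\<lambda>x. deriv G (w x)" and \<phi>' = "\<lambda>x. Im (G (w x)) / Im (w x)"])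
    show "s < t" using False st by simp
    have "continuous_on {s..t} w" using st by (intro continuous_on_subset[OF continuous_on_orbit]) auto
    moreover have "continuous_on (w ` {s..t}) l"
      using st Im_pos by (intro continuous_on_subset[OF holomorphic_on_imp_continuous_on[OF l(1)]]) auto
    ultimately show "continuous_on {s..t} (\<lambda>x. l (w x))" by (rule continuous_on_compose[unfolded o_def])
    show "continuous_on {s..t} (\<lambda>x. ln (Im (w x)))"
    proof (intro continuous_intros ballI \<open>continuous_on {s..t} w\<close>)
      show "Im (w x) \<noteq> 0" if "x \<in> {s..t}" for x using Im_pos[of x] st that by auto
    qed
  next
    fix x assume x: "s < x" "x < t"
    then have x0: "x > 0" "x \<ge> 0" using st by auto
    \<comment> \<open>Since \<open>w' = G w\<close>, the derivative of \<open>l\<close> along the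
      orbit is \<open>l' * G\<close>, which is \<open>G'\<close> itself; Schwarz-Pick bounds
      it.\<close>
    have "deriv G (w x) = deriv l (w x) * G (w x)"
    proof -
      have dl: "(l has_field_derivative deriv l (w x)) (at (w x))"
        using Im_pos x0 open_upper_half_plane by (intro holomorphic_derivI[OF l(1)]) auto
      have "((\<lambda>z. exp (l z)) has_field_derivative exp (l (w x)) * deriv l (w x)) (at (w x))"
        by (rule DERIV_fun_exp[OF dl])
      then have "(G has_field_derivative exp (l (w x)) * deriv l (w x)) (at (w x))"
        by (rule DERIV_cong_ev[THEN iffD1, rotated -1, OF _ refl])
          (use l(2) Im_pos x0 open_upper_half_plane in \<open>auto intro!: eventually_nhds_in_open[THEN eventually_mono]\<close>)
      then show ?thesis using DERIV_imp_deriv l(2) Im_pos[OF x0(2)] by (metis mem_upper_half_plane mult.commute)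
    qed
    then show "((\<lambda>x. l (w x)) has_vector_derivative deriv G (w x)) (at x)"
      using has_vector_derivative_orbit_compose[OF x0(2) l(1)] at_within_nonneg[OF x0(1)]
      by (simp add: mult.commute)
    have "((\<lambda>x. ln (Im (w x))) has_real_derivative 1 / Im (w x) * Im (G (w x))) (at x)"
      using Im_orbit_derivative[OF x0(2)] Im_pos[OF x0(2)] unfolding at_within_nonneg[OF x0(1)]
      by (intro DERIV_chain2[OF DERIV_ln_divide]) auto
    then show "((\<lambda>x. ln (Im (w x))) has_vector_derivative Im (G (w x)) / Im (w x)) (at x)"
      by (simp add: has_real_derivative_iff_has_vector_derivative)
    show "cmod (deriv G (w x)) \<le> Im (G (w x)) / Im (w x)"
      using Schwarz_Pick_deriv[OF nevanlinna Im_pos[OF x0(2)]] .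
  qed
qed simp

lemma obtain_log:
  obtains l where "l holomorphic_on \<H>" "\<And>z. z \<in> \<H> \<Longrightarrow> exp (l z) = G z"
proof (rule holomorphic_logarithm_exists[OF convex_upper_half_plane open_upper_half_plane nevanlinna_holomorphic[OF nevanlinna]])
  show "\<i> \<in> \<H>" by simp
qed (use nonzero that in auto)

lemma Im_mono:
  assumes "0 \<le> s" "s \<le> t"
  shows "Im (w s) \<le> Im (w t)"
proof -
  obtain l where l: "l holomorphic_on \<H>" "\<And>z. z \<in> \<H> \<Longrightarrow> exp (l z) = G z" by (rule obtain_log) blast
  have "ln (Im (w s)) \<le> ln (Im (w t))"
    using log_variation[OF l assms] norm_ge_zero by (meson diff_ge_0_iff_ge order_trans)
  then show ?thesis using Im_pos assms by simp
qed

text \<open>Real part of \<open>log_variation\<close>: the logarithm of the speed falls no faster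
  than that of the height rises.\<close>

lemma Im_times_speed_mono:
  assumes "0 \<le> s" "s \<le> t"
  shows "Im (w s) * cmod (G (w s)) \<le> Im (w t) * cmod (G (w t))"
proof -
  obtain l where l: "l holomorphic_on \<H>" "\<And>z. z \<in> \<H> \<Longrightarrow> exp (l z) = G z" by (rule obtain_log) blast
  have y: "Im (w s) > 0" "Im (w t) > 0" using Im_pos assms by auto
  have "Re (l (w s)) - Re (l (w t)) \<le> ln (Im (w t)) - ln (Im (w s))"
    using log_variation[OF l assms] abs_Re_le_cmod[of "l (w t) - l (w s)"] by simp
  then have "exp (ln (Im (w s)) + Re (l (w s))) \<le> exp (ln (Im (w t)) + Re (l (w t)))" by simp
  moreover have "cmod (G (w u)) = exp (Re (l (w u)))" if "Im (w u) > 0" for u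
    using l(2)[of "w u"] that by (metis mem_upper_half_plane norm_exp_eq_Re)
  ultimately show ?thesis using y by (simp add: exp_add)
qed

text \<open>If \<open>Im w\<close> grows at most by the factor \<open>e\<close> on \<open>[t, 4t]\<close>, then the velocity \<open>G w\<close>
  turns by at most one radian there, so the orbit cannot waste its speed by running back and forth.\<close>
lemma Im_lower_bound_of_slow_growth:
  assumes t: "t > 0" and slow: "Im (w (4 * t)) \<le> exp 1 * Im (w t)"
    and bound: "cmod (w t) \<le> C * sqrt t" "cmod (w (4 * t)) \<le> C * sqrt (4 * t)"
  shows "Im (w 0) * cmod (G (w 0)) * sqrt t \<le> 2 * C * Im (w (4 * t))"
proof -
  obtain l where l: "l holomorphic_on \<H>" "\<And>z. z \<in> \<H> \<Longrightarrow> exp (l z) = G z" by (rule obtain_log) blast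
  define v where "v = G (w t)"
  \<comment> \<open>The initial value of the nondecreasing product of height and speed; it bounds
    the speed \<open>cmod v\<close> from below.\<close>
  define c0 where "c0 = Im (w 0) * cmod (G (w 0))"
  have y: "Im (w t) > 0" "Im (w (4 * t)) > 0" using Im_pos t by auto
  have v: "cmod v > 0" using nonzero y by (simp add: v_def)
  have c0: "c0 \<le> Im (w t) * cmod v" "c0 \<ge> 0"
    using Im_times_speed_mono[of 0 t] t Im_pos[of 0] by (auto simp: v_def c0_def)
  \<comment> \<open>With \<open>G (w s) = v * exp k\<close>, the bound on \<open>k\<close> keeps the
    velocity component along \<open>v\<close> positive, so progress in that direction
    accumulates.\<close>
  have slope: "Re (G (w s) * cnj v) \<ge> cmod v * c0 / (2 * Im (w (4 * t)))" if s: "t \<le> s" "s \<le> 4 * t" for s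
  proof -
    define k where "k = l (w s) - l (w t)"
    define r where "r = ln (Im (w s)) - ln (Im (w t))"
    have ys: "Im (w s) > 0" "Im (w s) \<le> Im (w (4 * t))" using Im_pos Im_mono[of s "4*t"] s t by auto
    have kr: "cmod k \<le> r" unfolding k_def r_def using log_variation[OF l, of t s] s t by simp
    have "ln (Im (w s)) \<le> ln (exp 1 * Im (w t))"
      using ys slow by simp
    then have "r \<le> 1" using y by (simp add: r_def ln_mult)
    then have "Re (exp k) \<ge> exp (- r) / 2" using kr by (intro Re_exp_ge) auto
    moreover have "exp (- r) = Im (w t) / Im (w s)"
      using ys y by (simp add: r_def exp_diff)
    moreover have "Im (w t) / Im (w (4 * t)) / 2 \<le> Im (w t) / Im (w s) / 2"
      using ys y by (intro divide_right_mono divide_left_mono) auto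
    ultimately have Rek: "Re (exp k) \<ge> Im (w t) / Im (w (4 * t)) / 2" by simp
    have "G (w s) = v * exp k"
      using l(2)[of "w s"] l(2)[of "w t"] ys y nonzero[OF y(1)] by (simp add: k_def v_def exp_diff)
    then have "G (w s) * cnj v = of_real ((cmod v)\<^sup>2) * exp k"
      by (simp only: complex_norm_square mult_ac)
    then have "Re (G (w s) * cnj v) = (cmod v)\<^sup>2 * Re (exp k)" by (simp del: of_real_power)
    moreover have "(cmod v)\<^sup>2 * (Im (w t) / Im (w (4 * t)) / 2) \<le> (cmod v)\<^sup>2 * Re (exp k)"
      using Rek by (intro mult_left_mono) auto
    moreover have "cmod v * c0 / (2 * Im (w (4 * t))) \<le> cmod v * (Im (w t) * cmod v) / (2 * Im (w (4 * t)))"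
      using c0 y v by (intro divide_right_mono mult_left_mono) auto
    ultimately show ?thesis by (simp add: power2_eq_square algebra_simps)
  qed
  \<comment> \<open>The mean value theorem needs a real function, here the component of the orbit
    along \<open>v\<close>.\<close>
  have "\<exists>s. t < s \<and> s < 4 * t \<and> Re (w (4 * t) * cnj v) - Re (w t * cnj v) = (4 * t - t) * Re (G (w s) * cnj v)"
  proof (rule MVT2)
    fix s assume s: "t \<le> s" "s \<le> 4 * t"
    then have "(w has_vector_derivative G (w s)) (at s)"
      using orbit[of s] at_within_nonneg[of s] t by simp
    from bounded_linear.has_vector_derivative[OF bounded_linear_compose[OF bounded_linear_Re bounded_linear_mult_left[of "cnj v"]] this]
    show "((\<lambda>s. Re (w s * cnj v)) has_real_derivative Re (G (w s) * cnj v)) (at s)"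
      by (simp add: has_real_derivative_iff_has_vector_derivative)
  qed (use t in simp)
  then obtain s where s: "t < s" "s < 4 * t"
    "Re (w (4 * t) * cnj v) - Re (w t * cnj v) = (4 * t - t) * Re (G (w s) * cnj v)" by blast
  have "(3 * t) * (cmod v * c0 / (2 * Im (w (4 * t)))) \<le> (3 * t) * Re (G (w s) * cnj v)"
    using slope[of s] s t by (intro mult_left_mono) auto
  also have "\<dots> = Re ((w (4 * t) - w t) * cnj v)" using s(3) by (simp add: algebra_simps)
  also have "\<dots> \<le> cmod ((w (4 * t) - w t) * cnj v)" by (rule complex_Re_le_cmod)
  also have "\<dots> = cmod (w (4 * t) - w t) * cmod v" by (simp add: norm_mult)
  \<comment> \<open>\<open>C * sqrt (4 * t) + C * sqrt t = 3 * C * sqrt t\<close>; the 3 cancels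
    against the time span \<open>3 * t\<close>.\<close>
  also have "\<dots> \<le> (3 * C * sqrt t) * cmod v"
  proof (rule mult_right_mono)
    show "cmod (w (4 * t) - w t) \<le> 3 * C * sqrt t"
      using norm_triangle_ineq4[of "w (4 * t)" "w t"] bound by (simp add: real_sqrt_mult)
  qed simp
  finally have "cmod v * (3 * t * c0 / (2 * Im (w (4 * t)))) \<le> cmod v * (3 * C * sqrt t)"
    by (simp add: algebra_simps)
  then have "3 * t * c0 / (2 * Im (w (4 * t))) \<le> 3 * C * sqrt t"
    using v mult_left_le_imp_le by blast
  then have "t * c0 \<le> 2 * C * Im (w (4 * t)) * sqrt t" using y by (simp add: field_simps)
  then have "(c0 * sqrt t) * sqrt t \<le> (2 * C * Im (w (4 * t))) * sqrt t" using t by (simp add: algebra_simps)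
  then show ?thesis using t by (simp add: c0_def)
qed

text \<open>From one time \<open>T * 4 ^ n\<close> to the next, the normalised height either arrives
  above a fixed \<open>e1\<close> or gains a factor 5/4, so it eventually stays above
  \<open>e1\<close>. Monotonicity of the height fills in the times between.\<close>

theorem orbit_nontangential:
  assumes T: "T > 0" and bound: "\<And>t. t \<ge> T \<Longrightarrow> cmod (w t) \<le> C * sqrt t"
  obtains c where "c > 0" "\<forall>\<^sub>F t in at_top. c * sqrt t \<le> Im (w t)"
proof -
  define c0 where "c0 = Im (w 0) * cmod (G (w 0))"
  have c0: "c0 > 0" using Im_pos[of 0] nonzero[of "w 0"] by (simp add: c0_def)
  have "0 < cmod (w T)" using Im_pos[of T] T by auto
  then have C: "C > 0" using bound[of T] T by (smt (verit) mult_nonpos_nonneg real_sqrt_ge_zero)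
  \<comment> \<open>As \<open>2 ^ n = sqrt (4 ^ n)\<close>, \<open>u n\<close> is the height over
    the square root of the time, up to the factor \<open>sqrt T\<close>.\<close>
  define u where "u = (\<lambda>n. Im (w (T * 4 ^ n)) / 2 ^ n)"
  \<comment> \<open>What the slow-growth estimate yields for \<open>u (Suc n)\<close>: the 4 is its
    own 2 times the 2 from \<open>2 ^ Suc n\<close>.\<close>
  define e1 where "e1 = c0 * sqrt T / (4 * C)"
  have e1: "e1 > 0" using c0 C T by (simp add: e1_def)
  have sqrt4: "sqrt (4 ^ n) = 2 ^ n" for n
    by (rule real_sqrt_unique) (simp_all add: power_mult_distrib[symmetric] power2_eq_square)
  have u0: "u 0 > 0" using Im_pos[of T] T by (simp add: u_def)
  have growth: "u (Suc n) \<ge> e1 \<or> u (Suc n) \<ge> 5 / 4 * u n" for n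
  proof (cases "Im (w (4 * (T * 4 ^ n))) \<le> exp 1 * Im (w (T * 4 ^ n))")
    case True
    have "T * 1 \<le> T * 4 ^ n" using T by (intro mult_left_mono) auto
    then have "T \<le> T * 4 ^ n" "T \<le> 4 * (T * 4 ^ n)" using T by linarith+
    then have "c0 * sqrt (T * 4 ^ n) \<le> 2 * C * Im (w (4 * (T * 4 ^ n)))"
      unfolding c0_def using T True by (intro Im_lower_bound_of_slow_growth bound) auto
    then have "c0 * sqrt T * 2 ^ n \<le> 2 * C * Im (w (T * 4 ^ Suc n))"
      by (simp add: real_sqrt_mult sqrt4 mult.assoc mult.left_commute)
    then have "e1 \<le> u (Suc n)" using C by (simp add: e1_def u_def field_simps)
    then show ?thesis by simp
  next
    case False
    \<comment> \<open>\<open>1 + 1 + 1/2\<close> bounds \<open>exp 1\<close> from below; the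
      normalisation by \<open>2 ^ n\<close> halves the resulting gain 5/2 to 5/4.\<close>
    have "5 / 2 \<le> exp (1::real)" using exp_lower_Taylor_quadratic[of 1] by simp
    moreover have "Im (w (T * 4 ^ n)) > 0" using Im_pos T by simp
    ultimately have "5 / 2 * Im (w (T * 4 ^ n)) \<le> exp 1 * Im (w (T * 4 ^ n))" by simp
    then have "5 / 2 * Im (w (T * 4 ^ n)) \<le> Im (w (T * 4 ^ Suc n))" using False by (simp add: mult_ac)
    then show ?thesis by (simp add: u_def field_simps)
  qed
  have "\<exists>N. u N \<ge> e1"
  proof (rule ccontr)
    assume "\<not> (\<exists>N. u N \<ge> e1)"
    then have lt: "u n < e1" for n by (simp add: not_le)
    then have st: "u (Suc n) \<ge> 5 / 4 * u n" for n using growth[of n] by (meson not_le)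
    have ge: "u n \<ge> (5 / 4) ^ n * u 0" for n
    proof (induction n)
      case (Suc n)
      then show ?case using st[of n] by simp
    qed simp
    obtain n where "e1 / u 0 < (5 / 4) ^ n" using real_arch_pow[of "5/4"] by auto
    then have "e1 < (5 / 4) ^ n * u 0" using u0 by (simp only: pos_divide_less_eq)
    then show False using ge[of n] lt[of n] by linarith
  qed
  then obtain N where N: "u N \<ge> e1" by blast
  have uN: "u n \<ge> e1" if "n \<ge> N" for n
    using that
  proof (induction rule: dec_induct)
    case (step n)
    then show ?case using step.IH \<open>e1 > 0\<close> growth[of n] by linarith
  qed (rule N)
  \<comment> \<open>Between sampling times the height is at least its earlier sample, while
    \<open>sqrt t\<close> at most doubles; hence the 2 in \<open>e1 / (2 * sqrt T)\<close>.\<close>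
  have "\<forall>t. T * 4 ^ N \<le> t \<and> t \<le> T * 4 ^ n \<longrightarrow> e1 / (2 * sqrt T) * sqrt t \<le> Im (w t)" if "n \<ge> N" for n
    using that
  proof (induction rule: dec_induct)
    case base
    have "Im (w (T * 4 ^ N)) \<ge> e1 * 2 ^ N" using N by (simp add: u_def field_simps)
    moreover have "e1 / (2 * sqrt T) * sqrt (T * 4 ^ N) \<le> e1 * 2 ^ N"
      using T e1 by (simp add: real_sqrt_mult sqrt4)
    ultimately show ?case using order_antisym order_trans by fastforce
  next
    case (step n)
    show ?case
    proof (intro allI impI)
      fix t assume t: "T * 4 ^ N \<le> t \<and> t \<le> T * 4 ^ Suc n"
      show "e1 / (2 * sqrt T) * sqrt t \<le> Im (w t)"
      proof (cases "t \<le> T * 4 ^ n")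
        case False
        have "sqrt t \<le> sqrt (T * 4 ^ Suc n)" using t by simp
        also have "\<dots> = 2 * sqrt T * 2 ^ n" unfolding real_sqrt_mult sqrt4 by simp
        finally have "e1 / (2 * sqrt T) * sqrt t \<le> e1 / (2 * sqrt T) * (2 * sqrt T * 2 ^ n)"
          using e1 T by (intro mult_left_mono) auto
        also have "\<dots> = e1 * 2 ^ n" using T by simp
        also have "\<dots> \<le> Im (w (T * 4 ^ n))" using uN[OF step.hyps(1)] by (simp add: u_def field_simps)
        also have "\<dots> \<le> Im (w t)" using False T by (intro Im_mono) auto
        finally show ?thesis .
      qed (use step.IH t in blast)
    qed
  qed
  then have "e1 / (2 * sqrt T) * sqrt t \<le> Im (w t)" if t: "t \<ge> T * 4 ^ N" for t
  proof -
    obtain n where "t / T < 4 ^ n" using real_arch_pow[of 4] by auto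
    also have "(4::real) ^ n \<le> 4 ^ (max n N)" by (intro power_increasing) auto
    finally have "t \<le> T * 4 ^ (max n N)" using T by (simp add: field_simps)
    then show ?thesis
      using \<open>\<And>n. N \<le> n \<Longrightarrow> \<forall>t. T * 4 ^ N \<le> t \<and> t \<le> T * 4 ^ n \<longrightarrow> e1 / (2 * sqrt T) * sqrt t \<le> Im (w t)\<close>[of "max n N"] t
      by simp
  qed
  then have "\<forall>\<^sub>F t in at_top. e1 / (2 * sqrt T) * sqrt t \<le> Im (w t)"
    unfolding eventually_at_top_linorder by blast
  moreover have "e1 / (2 * sqrt T) > 0" using e1 T by simp
  ultimately show ?thesis using that by blast
qed

text \<open>The Koenigs function is, up to sign, a primitive of \<open>-1/G \<sim> \<beta> z\<close>; it grows linearly along the orbit.\<close>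
theorem orbit_squared_asymptotics:
  assumes \<beta>: "\<And>m \<epsilon>. m > 0 \<Longrightarrow> \<epsilon> > 0 \<Longrightarrow>
      \<exists>R>0. \<forall>z. Im z \<ge> m * cmod z \<longrightarrow> cmod z \<ge> R \<longrightarrow> cmod (- 1 / G z - of_real \<beta> * z) \<le> \<epsilon> * cmod z"
    and c: "c > 0" "\<forall>\<^sub>F t in at_top. c * sqrt t \<le> Im (w t)"
    and C: "\<forall>\<^sub>F t in at_top. cmod (w t) \<le> C * sqrt t"
  shows "((\<lambda>t. of_real \<beta> * ((w t)\<^sup>2 / of_real t)) \<longlongrightarrow> -2) at_top"
proof -
  define g where "g = (\<lambda>z. - 1 / G z)"
  have "g holomorphic_on \<H>" unfolding g_def
    using nevanlinna_holomorphic[OF nevanlinna] nonzero by (intro holomorphic_intros) auto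
  then obtain h where "\<And>z. z \<in> \<H> \<Longrightarrow> (h has_field_derivative g z) (at z within \<H>)"
    by (rule holomorphic_convex_primitive'[OF convex_upper_half_plane open_upper_half_plane]) blast
  then have h: "(h has_field_derivative g z) (at z)" if "Im z > 0" for z
    using that by (metis at_within_open mem_upper_half_plane open_upper_half_plane)
  have hol_h: "h holomorphic_on \<H>"
    unfolding holomorphic_on_open[OF open_upper_half_plane] using h by (metis mem_upper_half_plane)
  \<comment> \<open>Since \<open>h' * G = -1\<close>, the sum of \<open>h\<close> along the orbit
    and the time is constant.\<close>
  have hw: "h (w t) = h (w 0) - of_real t" if t: "t \<ge> 0" for t
  proof -
    obtain k where k: "\<And>s. s \<in> {0..} \<Longrightarrow> h (w s) + of_real s = k"
    proof (rule has_vector_derivative_zero_constant[of "{0..}" "\<lambda>s. h (w s) + of_real s"])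
      fix s :: real assume s: "s \<in> {0..}"
      then have "deriv h (w s) = g (w s)" using h Im_pos by (intro DERIV_imp_deriv) auto
      moreover have "G (w s) \<noteq> 0" using nonzero Im_pos s by auto
      ultimately have "((\<lambda>s. h (w s)) has_vector_derivative - 1) (at s within {0..})"
        using has_vector_derivative_orbit_compose[OF _ hol_h, of s] s by (simp add: g_def)
      then show "((\<lambda>s. h (w s) + of_real s) has_vector_derivative 0) (at s within {0..})"
        by (auto intro!: derivative_eq_intros)
    qed (use that in auto)
    from k[of t] k[of 0] t show ?thesis by (simp add: algebra_simps)
  qed
  \<comment> \<open>The deviation of \<open>h\<close> from its expected leading term; its derivative
    is \<open>o(z)\<close> in cones, so \<open>K (w t)\<close> should be
    \<open>o(t)\<close>.\<close>
  define K where "K = (\<lambda>z. h z - of_real \<beta> * z\<^sup>2 / 2)"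
  have K: "(K has_field_derivative (g z - of_real \<beta> * z)) (at z)" if "Im z > 0" for z
    unfolding K_def using h[OF that] by (auto intro!: derivative_eq_intros)
  have C0: "C > 0"
  proof -
    have "\<forall>\<^sub>F t in at_top. c * sqrt t \<le> C * sqrt t \<and> t > 0"
      using c(2) C eventually_gt_at_top[of 0]
    proof eventually_elim
      case (elim t)
      then show ?case using abs_Im_le_cmod[of "w t"] by linarith
    qed
    then obtain t where "c * sqrt t \<le> C * sqrt t" "t > 0"
      using eventually_happens'[OF trivial_limit_at_top_linorder] by blast
    then show ?thesis using c(1) by simp
  qed
  have K0: "((\<lambda>t. K (w t) / of_real t) \<longlongrightarrow> 0) at_top"
  proof (rule tendstoI)
    fix e :: real assume e: "e > 0"
    \<comment> \<open>The 8 makes the final bound \<open>2 * e' * C\<^sup>2 * t\<close> equal to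
      \<open>e / 4 * t\<close>. In \<open>m\<close>, the entry \<open>c / C\<close> puts the orbit
      into the cone and the 1 puts \<open>a\<close> there.\<close>
    define e' where "e' = e / (8 * C\<^sup>2)"
    define m where "m = min 1 (c / C)"
    have e': "e' > 0" and m: "m > 0" "m \<le> 1" using e C0 c by (auto simp: e'_def m_def)
    from \<beta>[OF m(1) e'] obtain R where R: "R > 0"
      "\<And>z. Im z \<ge> m * cmod z \<Longrightarrow> cmod z \<ge> R \<Longrightarrow> cmod (g z - of_real \<beta> * z) \<le> e' * cmod z"
      unfolding g_def by blast
    define a where "a = \<i> * complex_of_real R"
    have sq: "filterlim (\<lambda>t. A * sqrt t) at_top at_top" if "A > 0" for A :: real
      using that by (intro filterlim_tendsto_pos_mult_at_top[OF tendsto_const] sqrt_at_top) auto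
    have "\<forall>\<^sub>F t in at_top. R \<le> c * sqrt t" "\<forall>\<^sub>F t in at_top. R \<le> C * sqrt t"
      using sq c C0 by (auto simp: filterlim_at_top)
    moreover have "\<forall>\<^sub>F t in at_top. cmod (K a) * 4 / e \<le> t" by (rule eventually_ge_at_top)
    ultimately show "\<forall>\<^sub>F t in at_top. dist (K (w t) / of_real t) 0 < e"
      using c(2) C eventually_gt_at_top[of 0]
    proof eventually_elim
      case (elim t)
      \<comment> \<open>A convex set containing \<open>a\<close> and \<open>w t\<close>, so the
        segment between them stays where \<open>K\<close> has small derivative;
        \<open>Im z \<ge> R\<close> ensures \<open>cmod z \<ge> R\<close>.\<close>
      define S where "S = {z. Im z \<ge> m * cmod z} \<inter> {z. Im z \<ge> R} \<inter> cball 0 (C * sqrt t)"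
      have cone: "convex {z. Im z \<ge> m * cmod z}"
      proof (rule convexI)
        fix x y :: complex and u v :: real
        assume *: "x \<in> {z. Im z \<ge> m * cmod z}" "y \<in> {z. Im z \<ge> m * cmod z}" "0 \<le> u" "0 \<le> v" "u + v = 1"
        have "m * cmod (u *\<^sub>R x + v *\<^sub>R y) \<le> m * (u * cmod x + v * cmod y)"
          using norm_triangle_ineq[of "u *\<^sub>R x" "v *\<^sub>R y"] * m by (intro mult_left_mono) auto
        also have "\<dots> = u * (m * cmod x) + v * (m * cmod y)" by (simp add: algebra_simps)
        also have "\<dots> \<le> u * Im x + v * Im y" using * by (intro add_mono mult_left_mono) auto
        finally show "u *\<^sub>R x + v *\<^sub>R y \<in> {z. Im z \<ge> m * cmod z}" by simp
      qed
      have "convex S" unfolding S_def by (intro convex_Int cone convex_halfspace_Im_ge convex_cball)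
      moreover have "(K has_field_derivative (g z - of_real \<beta> * z)) (at z within S)" if "z \<in> S" for z
        using K[of z] that R by (auto simp: S_def intro: has_field_derivative_at_within)
      moreover have "cmod (g z - of_real \<beta> * z) \<le> e' * (C * sqrt t)" if "z \<in> S" for z
      proof -
        have "cmod z \<ge> R" using that abs_Im_le_cmod[of z] by (auto simp: S_def)
        then have "cmod (g z - of_real \<beta> * z) \<le> e' * cmod z" using R(2) that by (auto simp: S_def)
        also have "\<dots> \<le> e' * (C * sqrt t)" using that e' by (intro mult_left_mono) (auto simp: S_def)
        finally show ?thesis .
      qed
      moreover have "w t \<in> S"
      proof -
        have "m * cmod (w t) \<le> c / C * (C * sqrt t)"
          using elim c C0 m by (intro mult_mono) (auto simp: m_def)
        also have "\<dots> = c * sqrt t" using C0 by simp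
        finally show ?thesis using elim by (auto simp: S_def)
      qed
      moreover have "a \<in> S" using R m elim by (simp add: S_def a_def norm_mult mult_left_le_one_le)
      ultimately have "cmod (K (w t) - K a) \<le> e' * (C * sqrt t) * cmod (w t - a)"
        by (rule field_differentiable_bound)
      also have "\<dots> \<le> e' * (C * sqrt t) * (2 * (C * sqrt t))"
      proof (rule mult_left_mono)
        have "cmod a = R" using R by (simp add: a_def norm_mult)
        then show "cmod (w t - a) \<le> 2 * (C * sqrt t)"
          using norm_triangle_ineq4[of "w t" a] elim by linarith
      qed (use e' C0 elim in simp)
      also have "\<dots> = 2 * e' * C\<^sup>2 * (sqrt t * sqrt t)" by (simp add: power2_eq_square)
      also have "\<dots> = e / 4 * t" using elim C0 by (simp add: e'_def)
      finally have "cmod (K (w t) - K a) \<le> e / 4 * t" .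
      moreover have "cmod (K a) \<le> e / 4 * t" using elim e by (simp add: field_simps)
      ultimately have "cmod (K (w t)) \<le> e / 2 * t"
        using norm_triangle_sub[of "K (w t)" "K a"] by simp
      moreover have "e / 2 * t < e * t" using e elim by simp
      ultimately show ?case using elim by (simp add: norm_divide divide_less_eq)
    qed
  qed
  have inv: "((\<lambda>t::real. of_real (inverse t) :: complex) \<longlongrightarrow> of_real 0) at_top"
    by (intro tendsto_intros tendsto_inverse_0_at_top filterlim_ident)
  have "((\<lambda>t. 2 * (h (w 0) * of_real (inverse t) - 1 - K (w t) / of_real t))
      \<longlongrightarrow> 2 * (h (w 0) * of_real 0 - 1 - 0)) at_top"
    by (intro tendsto_mult tendsto_diff tendsto_const inv K0)
  then have "((\<lambda>t. 2 * (h (w 0) * of_real (inverse t) - 1 - K (w t) / of_real t)) \<longlongrightarrow> -2) at_top"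
    by simp
  then show ?thesis
  proof (rule Lim_transform_eventually)
    show "\<forall>\<^sub>F t in at_top. 2 * (h (w 0) * of_real (inverse t) - 1 - K (w t) / of_real t)
        = of_real \<beta> * ((w t)\<^sup>2 / of_real t)"
      using eventually_gt_at_top[of 0]
    proof eventually_elim
      case (elim t)
      have "h (w 0) = of_real t + h (w t)" using hw[of t] elim by simp
      with elim show ?case by (simp add: K_def field_simps)
    qed
  qed
qed

end

section \<open>Hyperbolic distance and the rate of convergence\<close>

text \<open>With \<open>a = |w + \<i>|\<close> and \<open>b = |w - \<i>|\<close> the quotient is
  \<open>(a + b) / (a - b)\<close>; extending by \<open>a + b\<close> makes the denominator
  \<open>a\<^sup>2 - b\<^sup>2 = 4 * Im w\<close>.\<close>

lemma hdist_ii: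
  assumes "Im w > 0"
  shows "hdist \<i> w = ln ((cmod (w + \<i>) + cmod (w - \<i>))\<^sup>2 / (4 * Im w)) / 2"
proof -
  define a b where "a = cmod (w + \<i>)" and "b = cmod (w - \<i>)"
  have eq: "a\<^sup>2 = b\<^sup>2 + 4 * Im w"
    using cmod_diff_cnj_squared[of w \<i>] by (simp add: a_def b_def)
  have "b \<ge> 0" "a \<ge> 0" by (auto simp: a_def b_def)
  moreover have "b < a" by (rule power2_less_imp_less) (use eq assms \<open>a \<ge> 0\<close> in auto)
  ultimately have "(1 + b / a) / (1 - b / a) = (a + b) / (a - b)"
    by (simp add: field_simps)
  also have "\<dots> = (a + b)\<^sup>2 / ((a + b) * (a - b))"
    using \<open>b < a\<close> \<open>b \<ge> 0\<close> by (simp add: power2_eq_square)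
  also have "(a + b) * (a - b) = 4 * Im w"
    using eq by (simp add: power2_eq_square algebra_simps)
  finally have "(1 + b / a) / (1 - b / a) = (a + b)\<^sup>2 / (4 * Im w)" .
  moreover have "cnj (\<i> - cnj w) = - (w + \<i>)" by simp
  then have "cmod (\<i> - cnj w) = a" unfolding a_def by (metis complex_mod_cnj norm_minus_cancel)
  moreover have "cmod (\<i> - w) = b" by (simp add: b_def norm_minus_commute)
  ultimately show ?thesis by (simp add: hdist_def a_def b_def)
qed

text \<open>The numerator has degree two and the denominator degree one, so scaling by
  \<open>sqrt t\<close> extracts \<open>1 / sqrt t\<close>, half of whose logarithm is
  \<open>- ln t / 4\<close>.\<close>

lemma hdist_ii_shifted:
  assumes "Im w > 0" "t > 0"
  shows "hdist \<i> w - ln t / 4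
    = ln ((cmod (w + \<i>) / sqrt t + cmod (w - \<i>) / sqrt t)\<^sup>2 / (4 * (Im w / sqrt t))) / 2"
proof -
  define S where "S = cmod (w + \<i>) + cmod (w - \<i>)"
  have "Im (w + \<i>) > 0" using assms by simp
  then have "cmod (w + \<i>) > 0" by (metis norm_zero zero_complex.sel(2) less_irrefl zero_less_norm_iff)
  then have "S > 0" unfolding S_def by (intro add_pos_nonneg) auto
  have st: "sqrt t > 0" using assms by simp
  have "(cmod (w + \<i>) / sqrt t + cmod (w - \<i>) / sqrt t)\<^sup>2 / (4 * (Im w / sqrt t)) = S\<^sup>2 / (4 * Im w) / sqrt t"
  proof -
    have "(S / r)\<^sup>2 / (4 * (y / r)) = S\<^sup>2 / (4 * y) / r" if "r > 0" for r y :: real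
      using that by (simp add: power2_eq_square)
    from this[OF st] show ?thesis unfolding S_def add_divide_distrib .
  qed
  moreover have "ln (S\<^sup>2 / (4 * Im w) / sqrt t) = ln (S\<^sup>2 / (4 * Im w)) - ln t / 2"
    using st assms \<open>S > 0\<close> by (subst ln_div) (auto simp: ln_sqrt)
  ultimately show ?thesis unfolding hdist_ii[OF assms(1)] S_def[symmetric] by (simp add: diff_divide_distrib)
qed

text \<open>The shifts by \<open>\<i>\<close> vanish after division by \<open>sqrt t\<close>, so the
  argument of the logarithm tends to \<open>(L + L)\<^sup>2 / (4 * L) = L\<close>.\<close>

lemma hdist_ii_asymptotics:
  assumes L: "L > 0" and w: "\<forall>\<^sub>F t in at_top. Im (w t) > 0"
    and mod: "((\<lambda>t. cmod (w t) / sqrt t) \<longlongrightarrow> L) at_top"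
    and im: "((\<lambda>t. Im (w t) / sqrt t) \<longlongrightarrow> L) at_top"
  shows "((\<lambda>t. hdist \<i> (w t) - ln t / 4) \<longlongrightarrow> ln L / 2) at_top"
proof -
  have inv: "((\<lambda>t. 1 / sqrt t) \<longlongrightarrow> 0) at_top"
    using tendsto_inverse_0_at_top[OF sqrt_at_top] by (simp add: inverse_eq_divide)
  have shift: "((\<lambda>t. cmod (w t + a) / sqrt t) \<longlongrightarrow> L) at_top" if a: "cmod a = 1" for a
  proof (rule tendsto_sandwich)
    have ev: "\<forall>\<^sub>F t in at_top. (t::real) > 0" by (rule eventually_gt_at_top)
    show "\<forall>\<^sub>F t in at_top. cmod (w t) / sqrt t - 1 / sqrt t \<le> cmod (w t + a) / sqrt t"
      using ev
    proof eventually_elim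
      case (elim t)
      have "cmod (w t) - 1 \<le> cmod (w t + a)" using norm_diff_ineq[of "w t" a] a by simp
      then show ?case using elim by (simp add: diff_divide_distrib[symmetric] divide_right_mono)
    qed
    show "\<forall>\<^sub>F t in at_top. cmod (w t + a) / sqrt t \<le> cmod (w t) / sqrt t + 1 / sqrt t"
      using ev
    proof eventually_elim
      case (elim t)
      have "cmod (w t + a) \<le> cmod (w t) + 1" using norm_triangle_ineq[of "w t" a] a by simp
      then show ?case using elim by (simp add: add_divide_distrib[symmetric] divide_right_mono)
    qed
    show "((\<lambda>t. cmod (w t) / sqrt t - 1 / sqrt t) \<longlongrightarrow> L) at_top"
      using tendsto_diff[OF mod inv] by simp
    show "((\<lambda>t. cmod (w t) / sqrt t + 1 / sqrt t) \<longlongrightarrow> L) at_top"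
      using tendsto_add[OF mod inv] by simp
  qed
  have "((\<lambda>t. ln ((cmod (w t + \<i>) / sqrt t + cmod (w t - \<i>) / sqrt t)\<^sup>2 / (4 * (Im (w t) / sqrt t))) / 2)
      \<longlongrightarrow> ln ((L + L)\<^sup>2 / (4 * L)) / 2) at_top"
    using shift[of \<i>] shift[of "- \<i>"] L by (intro tendsto_intros im) auto
  moreover have "(L + L)\<^sup>2 / (4 * L) = L" using L by (simp add: power2_eq_square field_simps)
  ultimately have "((\<lambda>t. ln ((cmod (w t + \<i>) / sqrt t + cmod (w t - \<i>) / sqrt t)\<^sup>2 / (4 * (Im (w t) / sqrt t))) / 2)
      \<longlongrightarrow> ln L / 2) at_top" by (simp only:)
  then show ?thesis
  proof (rule Lim_transform_eventually)
    show "\<forall>\<^sub>F t in at_top. ln ((cmod (w t + \<i>) / sqrt t + cmod (w t - \<i>) / sqrt t)\<^sup>2 / (4 * (Im (w t) / sqrt t))) / 2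
        = hdist \<i> (w t) - ln t / 4"
      using w eventually_gt_at_top[of 0] by eventually_elim (simp only: hdist_ii_shifted)
  qed
qed

text \<open>As \<open>|w + \<i>| + |w - \<i>| \<ge> 2 * |w|\<close> and
  \<open>Im w \<le> |w|\<close>, the argument of the logarithm is at least
  \<open>|w| / sqrt t\<close>. A bound \<open>n\<close> on half the logarithm gives
  \<open>C = exp (2 * n)\<close>.\<close>

lemma sqrt_bound_of_Limsup_hdist:
  assumes w: "\<forall>\<^sub>F t in at_top. Im (w t) > 0"
    and lim: "Limsup at_top (\<lambda>t. ereal (hdist \<i> (w t) - ln t / 4)) < \<infinity>"
  obtains C where "\<forall>\<^sub>F t in at_top. cmod (w t) \<le> C * sqrt t"
proof -
  have "Limsup at_top (\<lambda>t. ereal (hdist \<i> (w t) - ln t / 4)) \<noteq> \<infinity>" using lim by auto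
  then obtain n where "Limsup at_top (\<lambda>t. ereal (hdist \<i> (w t) - ln t / 4)) < ereal (real n)"
    unfolding less_PInf_Ex_of_nat by blast
  then have "\<forall>\<^sub>F t in at_top. ereal (hdist \<i> (w t) - ln t / 4) < ereal (real n)"
    by (rule Limsup_lessD)
  then have "\<forall>\<^sub>F t in at_top. cmod (w t) \<le> exp (2 * real n) * sqrt t"
    using w eventually_gt_at_top[of 0]
  proof eventually_elim
    case (elim t)
    define A where "A = (cmod (w t + \<i>) / sqrt t + cmod (w t - \<i>) / sqrt t)\<^sup>2 / (4 * (Im (w t) / sqrt t))"
    have st: "sqrt t > 0" using elim by simp
    have cw: "0 < cmod (w t)" using elim by auto
    have "2 * cmod (w t) = cmod ((w t + \<i>) + (w t - \<i>))" by (simp add: norm_mult)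
    also have "\<dots> \<le> cmod (w t + \<i>) + cmod (w t - \<i>)" by (rule norm_triangle_ineq)
    finally have "2 * cmod (w t) / sqrt t \<le> cmod (w t + \<i>) / sqrt t + cmod (w t - \<i>) / sqrt t"
      using st by (simp add: add_divide_distrib[symmetric] divide_right_mono)
    then have "(2 * cmod (w t) / sqrt t)\<^sup>2 \<le> (cmod (w t + \<i>) / sqrt t + cmod (w t - \<i>) / sqrt t)\<^sup>2"
      using st by (intro power_mono) auto
    then have "(2 * cmod (w t) / sqrt t)\<^sup>2 / (4 * (cmod (w t) / sqrt t)) \<le> A"
      unfolding A_def using elim st cw abs_Im_le_cmod[of "w t"]
      by (intro frac_le) (auto intro!: divide_right_mono)
    moreover have "(2 * cmod (w t) / sqrt t)\<^sup>2 / (4 * (cmod (w t) / sqrt t)) = cmod (w t) / sqrt t"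
      using st cw by (simp add: power2_eq_square field_simps)
    ultimately have A: "cmod (w t) / sqrt t \<le> A" by simp
    moreover have "0 < cmod (w t) / sqrt t" using st cw by simp
    ultimately have "A > 0" by linarith
    moreover have "ln A \<le> 2 * real n"
      using elim hdist_ii_shifted[of "w t" t] by (simp add: A_def)
    ultimately have "A \<le> exp (2 * real n)" by (metis exp_le_cancel_iff exp_ln)
    with A have "cmod (w t) / sqrt t \<le> exp (2 * real n)" by linarith
    then show ?case using st by (simp only: pos_divide_le_eq)
  qed
  then show ?thesis using that by blast
qed

text \<open>Harnack carries the growth bound from one orbit to all, and the angular derivative
  \<open>\<beta>\<close> of \<open>-1/G\<close>, the same for every orbit, determines
  \<open>L\<close>.\<close>

lemma (in parabolic_semigroup) flow_rate:
  assumes noneli: "nonelliptic_DW_infty \<phi>" and z0: "Im z0 > 0"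
    and C0: "\<forall>\<^sub>F t in at_top. cmod (\<phi> t z0) \<le> C0 * sqrt t"
  obtains L where "L > 0"
    and "\<And>z. Im z > 0 \<Longrightarrow> ((\<lambda>t. cmod (\<phi> t z) / sqrt t) \<longlongrightarrow> L) at_top"
    and "\<And>z. Im z > 0 \<Longrightarrow> ((\<lambda>t. Im (\<phi> t z) / sqrt t) \<longlongrightarrow> L) at_top"
proof -
  obtain G where G: "nevanlinna G" and dG: "\<And>z t. Im z > 0 \<Longrightarrow> t \<ge> 0 \<Longrightarrow>
      ((\<lambda>t. \<phi> t z) has_vector_derivative G (\<phi> t z)) (at t within {0..})"
    using generator_exists by blast
  \<comment> \<open>By Schwarz-Pick a zero makes \<open>G\<close> vanish identically, so
    \<open>z\<close> would stay fixed, against nonellipticity.\<close>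
  have nz: "G z \<noteq> 0" if z: "Im z > 0" for z
  proof
    assume "G z = 0"
    then have zero: "G u = 0" if "Im u > 0" for u
      using Schwarz_Pick[OF G that z] that z by (simp add: mult_le_0_iff)
    obtain k where k: "\<And>s. s \<in> {0..} \<Longrightarrow> \<phi> s z = k"
    proof (rule has_vector_derivative_zero_constant[of "{0..}" "\<lambda>s. \<phi> s z"])
      fix s :: real assume "s \<in> {0..}"
      then show "((\<lambda>s. \<phi> s z) has_vector_derivative 0) (at s within {0..})"
        using dG[OF z, of s] zero[of "\<phi> s z"] z by simp
    qed (use that in auto)
    from k[of 1] k[of 0] z have "\<phi> 1 z = z" by simp
    then show False using noneli z unfolding nonelliptic_DW_infty_def by simp
  qed
  have "nevanlinna (\<lambda>z. - 1 / G z)"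
  proof (rule nevanlinnaI)
    show "(\<lambda>z. - 1 / G z) holomorphic_on \<H>"
      using nevanlinna_holomorphic[OF G] nz by (intro holomorphic_intros) auto
    show "Im (- 1 / G z) \<ge> 0" if "Im z > 0" for z
      using nevanlinna_Im[OF G that] by (simp add: Im_divide)
  qed
  then obtain \<beta> where b: "\<beta> \<ge> 0"
    and \<beta>: "\<And>m \<epsilon>. m > 0 \<Longrightarrow> \<epsilon> > 0 \<Longrightarrow>
      \<exists>R>0. \<forall>z. Im z \<ge> m * cmod z \<longrightarrow> cmod z \<ge> R \<longrightarrow> cmod (- 1 / G z - of_real \<beta> * z) \<le> \<epsilon> * cmod z"
    by (rule nevanlinna_angular_derivative) blast
  have lim: "((\<lambda>t. of_real \<beta> * ((\<phi> t z)\<^sup>2 / of_real t)) \<longlongrightarrow> -2) at_top" if z: "Im z > 0" for z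
  proof -
    interpret nevanlinna_orbit G "\<lambda>t. \<phi> t z"
      by unfold_locales (use G nz dG z in auto)
    \<comment> \<open>Harnack is applied to the map \<open>\<phi> t\<close> at \<open>z\<close> and
      \<open>z0\<close>; \<open>D\<close> does not depend on \<open>t\<close>.\<close>
    define D where "D = (cmod (z - z0))\<^sup>2 / (Im z * Im z0)"
    have D: "(cmod (z - z0))\<^sup>2 \<le> D * (Im z * Im z0)" "D \<ge> 0"
      using z z0 by (simp_all add: D_def)
    have "\<forall>\<^sub>F t in at_top. cmod (\<phi> t z) \<le> ((2 + 2 * D) * C0) * sqrt t"
      using C0 eventually_ge_at_top[of 0]
    proof eventually_elim
      case (elim t)
      have "cmod (\<phi> t z - \<phi> t z0) \<le> (1 + 2 * D) * Im (\<phi> t z0)"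
        by (rule nevanlinna_diff_le[OF nevanlinna_flow[OF elim(2)] z z0 D(1)])
      also have "\<dots> \<le> (1 + 2 * D) * (C0 * sqrt t)"
        using elim abs_Im_le_cmod[of "\<phi> t z0"] D(2) by (intro mult_left_mono) auto
      finally show ?case
        using norm_triangle_sub[of "\<phi> t z" "\<phi> t z0"] elim by (simp add: algebra_simps)
    qed
    then obtain T where T: "\<And>t. t \<ge> T \<Longrightarrow> cmod (\<phi> t z) \<le> ((2 + 2 * D) * C0) * sqrt t"
      unfolding eventually_at_top_linorder by blast
    obtain c where c: "c > 0" "\<forall>\<^sub>F t in at_top. c * sqrt t \<le> Im (\<phi> t z)"
      by (rule orbit_nontangential[of "max T 1" "(2 + 2 * D) * C0"]) (use T in auto)
    show ?thesis
      by (rule orbit_squared_asymptotics[OF \<beta> c]) (use T eventually_at_top_linorder in blast)+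
  qed
  have "\<beta> \<noteq> 0"
  proof
    assume "\<beta> = 0"
    with lim[of \<i>] have "((\<lambda>t::real. 0::complex) \<longlongrightarrow> -2) at_top" by simp
    then show False by (simp add: tendsto_const_iff)
  qed
  \<comment> \<open>\<open>(\<phi> t z)\<^sup>2 / t\<close> tends to \<open>-2 / \<beta>\<close>,
    which has to be \<open>- L\<^sup>2\<close>.\<close>
  define L where "L = sqrt (2 / \<beta>)"
  have bpos: "\<beta> > 0" using b \<open>\<beta> \<noteq> 0\<close> by simp
  have L: "L > 0" "L\<^sup>2 = 2 / \<beta>" using bpos by (auto simp: L_def)
  have sqr: "((\<lambda>t. (\<phi> t z)\<^sup>2 / of_real t) \<longlongrightarrow> of_real (- L\<^sup>2)) at_top" if z: "Im z > 0" for z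
  proof -
    have "((\<lambda>t. of_real \<beta> * ((\<phi> t z)\<^sup>2 / of_real t) / of_real \<beta>) \<longlongrightarrow> -2 / of_real \<beta>) at_top"
      using \<open>\<beta> \<noteq> 0\<close> by (intro tendsto_divide lim[OF z] tendsto_const) auto
    then show ?thesis using \<open>\<beta> \<noteq> 0\<close> by (simp add: L(2))
  qed
  have mod2: "((\<lambda>t. (cmod (\<phi> t z))\<^sup>2 / t) \<longlongrightarrow> L\<^sup>2) at_top" if z: "Im z > 0" for z
  proof -
    have "((\<lambda>t. cmod ((\<phi> t z)\<^sup>2 / of_real t)) \<longlongrightarrow> cmod (of_real (- L\<^sup>2))) at_top"
      by (intro tendsto_norm sqr z)
    then have "((\<lambda>t. cmod ((\<phi> t z)\<^sup>2 / of_real t)) \<longlongrightarrow> L\<^sup>2) at_top"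
      unfolding norm_of_real by simp
    then show ?thesis
      by (rule Lim_transform_eventually)
        (rule eventually_mono[OF eventually_gt_at_top[of 0]], simp add: norm_divide norm_power)
  qed
  \<comment> \<open>The limit of the squares is a negative real, so
    \<open>(Im u)\<^sup>2 = (|u|\<^sup>2 - Re (u\<^sup>2)) / 2\<close> gives the imaginary part the
    same rate as the modulus.\<close>
  have im2: "((\<lambda>t. (Im (\<phi> t z))\<^sup>2 / t) \<longlongrightarrow> L\<^sup>2) at_top" if z: "Im z > 0" for z
  proof -
    have "((\<lambda>t. ((cmod (\<phi> t z))\<^sup>2 / t - Re ((\<phi> t z)\<^sup>2 / of_real t)) / 2) \<longlongrightarrow> (L\<^sup>2 - Re (of_real (- L\<^sup>2))) / 2) at_top"
      by (intro tendsto_intros mod2 sqr z) auto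
    moreover have "((cmod u)\<^sup>2 / t - Re (u\<^sup>2 / of_real t)) / 2 = (Im u)\<^sup>2 / t" for u and t :: real
    proof -
      have "(cmod u)\<^sup>2 - Re (u\<^sup>2) = 2 * (Im u)\<^sup>2" by (simp add: cmod_power2) (simp add: power2_eq_square)
      then show ?thesis by (simp add: diff_divide_distrib[symmetric])
    qed
    moreover have "(L\<^sup>2 - Re (of_real (- L\<^sup>2))) / 2 = L\<^sup>2" by (simp only: Re_complex_of_real) simp
    ultimately show ?thesis by (simp only:)
  qed
  have root: "((\<lambda>t. f t / sqrt t) \<longlongrightarrow> L) at_top"
    if "((\<lambda>t. (f t)\<^sup>2 / t) \<longlongrightarrow> L\<^sup>2) at_top" "\<And>t. t \<ge> 0 \<Longrightarrow> f t \<ge> 0" for f :: "real \<Rightarrow> real"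
  proof -
    have "((\<lambda>t. sqrt ((f t)\<^sup>2 / t)) \<longlongrightarrow> sqrt (L\<^sup>2)) at_top" by (intro tendsto_real_sqrt that)
    then have "((\<lambda>t. sqrt ((f t)\<^sup>2 / t)) \<longlongrightarrow> L) at_top"
      unfolding real_sqrt_abs using L(1) by simp
    then show ?thesis
      by (rule Lim_transform_eventually)
        (rule eventually_mono[OF eventually_gt_at_top[of 0]], simp add: real_sqrt_divide that(2))
  qed
  show ?thesis
  proof (rule that[OF L(1)])
    fix z assume z: "Im z > 0"
    show "((\<lambda>t. cmod (\<phi> t z) / sqrt t) \<longlongrightarrow> L) at_top" by (rule root[OF mod2[OF z]]) simp
    show "((\<lambda>t. Im (\<phi> t z) / sqrt t) \<longlongrightarrow> L) at_top"
      by (rule root[OF im2[OF z]]) (use z in \<open>auto intro: less_imp_le\<close>)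
  qed
qed

theorem theorem6p1:
  fixes \<phi> :: "real \<Rightarrow> complex \<Rightarrow> complex"
  assumes "semigroup_H \<phi>" and "nonelliptic_DW_infty \<phi>"
    and "parabolic_H \<phi>" and "zero_hyp_step \<phi>"
  shows
    "(extremal_rate \<phi> \<longleftrightarrow>
        (\<exists>z\<in>\<H>. Limsup at_top (\<lambda>t. ereal (hdist \<i> (\<phi> t z) - ln t / 4)) < \<infinity>)) \<and>
     (extremal_rate \<phi> \<longleftrightarrow>
        (\<forall>z\<in>\<H>. Limsup at_top (\<lambda>t. ereal (hdist \<i> (\<phi> t z) - ln t / 4)) < \<infinity>)) \<and>
     (extremal_rate \<phi> \<longleftrightarrow>
        (\<exists>z\<in>\<H>. \<exists>l::real. ((\<lambda>t. hdist \<i> (\<phi> t z) - ln t / 4) \<longlongrightarrow> l) at_top)) \<and>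
     (extremal_rate \<phi> \<longleftrightarrow>
        (\<forall>z\<in>\<H>. \<exists>l::real. ((\<lambda>t. hdist \<i> (\<phi> t z) - ln t / 4) \<longlongrightarrow> l) at_top)) \<and>
     (extremal_rate \<phi> \<longrightarrow>
        (\<forall>L. ((\<lambda>t. cmod (\<phi> t \<i>) / sqrt t) \<longlongrightarrow> L) at_top \<longrightarrow>
           (\<forall>z\<in>\<H>. ((\<lambda>t. hdist \<i> (\<phi> t z) - ln t / 4) \<longlongrightarrow> ln L / 2) at_top)))"
proof -
  interpret parabolic_semigroup \<phi> by unfold_locales fact+
  let ?d = "\<lambda>z t. hdist \<i> (\<phi> t z) - ln t / 4"
  \<comment> \<open>The hub of all equivalences: each condition, even for a single \<open>z\<close>,
    implies \<open>B\<close>, and \<open>B\<close> implies each of them for all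
    \<open>z\<close>.\<close>
  define B where "B \<longleftrightarrow> (\<exists>z\<in>\<H>. \<exists>C. \<forall>\<^sub>F t in at_top. cmod (\<phi> t z) \<le> C * sqrt t)"
  have iH: "\<i> \<in> \<H>" by simp
  have Im_ev: "\<forall>\<^sub>F t in at_top. Im (\<phi> t z) > 0" if "z \<in> \<H>" for z
    using eventually_ge_at_top[of 0] by eventually_elim (use that in simp)
  have rate: "\<exists>L>0. \<forall>z\<in>\<H>. ((\<lambda>t. cmod (\<phi> t z) / sqrt t) \<longlongrightarrow> L) at_top \<and> (?d z \<longlongrightarrow> ln L / 2) at_top"
    if B
  proof -
    from that obtain z0 C0 where "Im z0 > 0" "\<forall>\<^sub>F t in at_top. cmod (\<phi> t z0) \<le> C0 * sqrt t"
      unfolding B_def by auto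
    from flow_rate[OF assms(2) this] obtain L where L: "L > 0"
      "\<And>z. Im z > 0 \<Longrightarrow> ((\<lambda>t. cmod (\<phi> t z) / sqrt t) \<longlongrightarrow> L) at_top"
      "\<And>z. Im z > 0 \<Longrightarrow> ((\<lambda>t. Im (\<phi> t z) / sqrt t) \<longlongrightarrow> L) at_top" by blast
    then show ?thesis using hdist_ii_asymptotics[OF L(1) Im_ev] by (intro exI[of _ L]) auto
  qed
  have ext_B: B if e: "extremal_rate \<phi>"
  proof -
    from e obtain L where "((\<lambda>t. cmod (\<phi> t \<i>) / sqrt t) \<longlongrightarrow> L) at_top"
      unfolding extremal_rate_def using iH by blast
    then have "\<forall>\<^sub>F t in at_top. cmod (\<phi> t \<i>) / sqrt t < L + 1" by (rule order_tendstoD) simp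
    then have "\<forall>\<^sub>F t in at_top. cmod (\<phi> t \<i>) \<le> (L + 1) * sqrt t"
      using eventually_gt_at_top[of 0] by eventually_elim (simp add: divide_less_eq)
    then show ?thesis unfolding B_def using iH by blast
  qed
  have B_ext: "extremal_rate \<phi>" if B using rate[OF that] unfolding extremal_rate_def by blast
  have lim_Limsup: "Limsup at_top (\<lambda>t. ereal (?d z t)) < \<infinity>" if "(?d z \<longlongrightarrow> l) at_top" for z l
  proof -
    have "((\<lambda>t. ereal (?d z t)) \<longlongrightarrow> ereal l) at_top" using that by simp
    from lim_imp_Limsup[OF _ this] show ?thesis by simp
  qed
  have Limsup_B: B if "z \<in> \<H>" "Limsup at_top (\<lambda>t. ereal (?d z t)) < \<infinity>" for z
    unfolding B_def using sqrt_bound_of_Limsup_hdist[OF Im_ev[OF that(1)] that(2)] that(1) by metis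
  have "(?d z \<longlongrightarrow> ln L / 2) at_top"
    if B "((\<lambda>t. cmod (\<phi> t \<i>) / sqrt t) \<longlongrightarrow> L) at_top" and z: "z \<in> \<H>" for L z
  proof -
    from rate[OF that(1)] obtain L' where L': "((\<lambda>t. cmod (\<phi> t \<i>) / sqrt t) \<longlongrightarrow> L') at_top"
      "(?d z \<longlongrightarrow> ln L' / 2) at_top" using iH z by blast
    \<comment> \<open>Uniqueness of limits identifies the given limit with the one produced by
      \<open>rate\<close>.\<close>
    have "L = L'" using tendsto_unique[OF _ that(2) L'(1)] by simp
    then show ?thesis using L'(2) by simp
  qed
  then show ?thesis
    using iH rate ext_B B_ext lim_Limsup Limsup_B by meson
qed

end
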